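(* Let $D_n$ be the degree (in-degree) of the sink in a random series-parallel network of size $n$ generated by the binary model. Then, as $n\to\infty$, $$\frac{D_n}{n^{\sqrt2-1}}\xrightarrow{(d)}D,$$ where $D$ is determined by its integer moments $$\mathbb{E}(D^r)=\frac{r!\,\big(r(\sqrt2-1)+1\big)\,\tilde c_r}{\Gamma\big(r(\sqrt2-1)+1\big)},\qquad r\ge0,$$ with $\tilde c_0=1$, $\tilde c_1=\frac{1+\sqrt2}{2\sqrt2}$, and for $r\ge2$ $$\tilde c_r=\frac{1}{\big(r(\sqrt2-1)+1\big)^2-2}\sum_{k=1}^{r-1}\tilde c_k\tilde c_{r-k}.$$
   Context: Binary (uniform binary saturation) model of series-parallel networks: directed graphs with a source and a sink, edges oriented towards the sink. At step $1$ the network is a single edge from the source to the sink. At step $n>1$ one of the $n-1$ edges $(x,y)$ is chosen uniformly at random. If $x$ has out-degree $1$, a new parallel edge $(x,y)$ is added; if $x$ has out-degree $2$, $(x,y)$ is replaced by $(x,z),(z,y)$ with $z$ a new vertex. The network after step $n$ has size $n$ ($n$ edges). *)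

theory Defs
  imports "HOL-Probability.Probability"
begin

text \<open>A network is a list of directed edges (x,y) between natural-number vertices.
  Parallel edges are separate list entries. Vertex 0 is the source, vertex 1 the sink.\<close>

type_synonym network = "(nat \<times> nat) list"

definition sp_source :: nat where "sp_source = 0"
definition sp_sink :: nat where "sp_sink = 1"

definition outdeg :: "network \<Rightarrow> nat \<Rightarrow> nat" where
  "outdeg G v = length (filter (\<lambda>e. fst e = v) G)"

definition indeg :: "network \<Rightarrow> nat \<Rightarrow> nat" where
  "indeg G v = length (filter (\<lambda>e. snd e = v) G)"

definition fresh_vertex :: "network \<Rightarrow> nat" where
  "fresh_vertex G = Suc (Max (insert sp_sink (fst ` set G \<union> snd ` set G)))"

text \<open>One growth step applied to the edge with index i.  If the tail x has out-degree 1,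
  a parallel copy of (x,y) is added; otherwise (out-degree 2) (x,y) is replaced by
  (x,z),(z,y) for a fresh vertex z.\<close>
definition sp_step :: "network \<Rightarrow> nat \<Rightarrow> network" where
  "sp_step G i = (let (x, y) = G ! i in
     if outdeg G x = 1 then G @ [(x, y)]
     else (let z = fresh_vertex G in G[i := (x, z)] @ [(z, y)]))"

text \<open>sp_net_aux k is the random network after step k+1, i.e. of size k+1.\<close>
primrec sp_net_aux :: "nat \<Rightarrow> network pmf" where
  "sp_net_aux 0 = return_pmf [(sp_source, sp_sink)]"
| "sp_net_aux (Suc k) =
     bind_pmf (sp_net_aux k) (\<lambda>G. map_pmf (sp_step G) (pmf_of_set {..<length G}))"

definition sp_network :: "nat \<Rightarrow> network pmf" where
  "sp_network n = sp_net_aux (n - 1)"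

definition scaled_sink_degree :: "nat \<Rightarrow> real measure" where
  "scaled_sink_degree n =
     measure_pmf (map_pmf (\<lambda>G. real (indeg G sp_sink) / real n powr (sqrt 2 - 1)) (sp_network n))"

fun ctilde :: "nat \<Rightarrow> real" where
  "ctilde 0 = 1"
| "ctilde (Suc 0) = (1 + sqrt 2) / (2 * sqrt 2)"
| "ctilde (Suc (Suc n)) =
     (1 / ((real (Suc (Suc n)) * (sqrt 2 - 1) + 1)^2 - 2)) *
     (\<Sum>k\<in>{1..Suc n}. ctilde k * ctilde (Suc (Suc n) - k))"

end

theory Submission
  imports Defs "HOL-Real_Asymp.Real_Asymp"
begin

text \<open>
  Call an edge into the sink of type \<open>a\<close> if its tail has out-degree 1 and of type \<open>b\<close> otherwise.
  Choosing a type \<open>a\<close> edge changes the counts by \<open>(-1, +2)\<close>, choosing a type \<open>b\<close> edge changes them by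
  \<open>(+1, -1)\<close>, and all other edges leave them alone, so \<open>(a, b)\<close> is a Markov chain. With
  \<open>h\<^sub>b = \<Sum> c\<^sub>r s\<^sup>r\<close> for the given sequence \<open>c\<close> and \<open>h\<^sub>a = h\<^sub>b + \<lambda>\<^sub>0 s h\<^sub>b'\<close>, where \<open>\<lambda>\<^sub>0 = sqrt 2 - 1\<close>, the
  recurrence for \<open>c\<close> says exactly that \<open>f\<^sub>r(a, b) = r! [s\<^sup>r] h\<^sub>a\<^sup>a h\<^sub>b\<^sup>b\<close> is an eigenfunction of the generator
  with eigenvalue \<open>r \<lambda>\<^sub>0\<close>. Hence the expectation of \<open>f\<^sub>r\<close> is an explicit quotient of Gamma functions.
  Since \<open>f\<^sub>r\<close> is the \<open>r\<close>-th power of the linear form \<open>c\<^sub>1 (sqrt 2 a + b)\<close> up to lower degree, all moments of this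
  form converge after scaling. Their growth is slow enough for the method of moments, and the
  degree \<open>a + b\<close> differs from the form only by a multiple of \<open>b - sqrt 2 a\<close>, which is of smaller order in mean square.
\<close>

section \<open>The method of moments\<close>

text \<open>Chebyshev's inequality: the mass outside \<open>{-K<..K}\<close> is at most
  \<open>C / K ^ 2\<close>, uniformly in \<open>n\<close>.\<close>

lemma tight_if_second_moments_bounded:
  fixes \<mu> :: "nat \<Rightarrow> real measure"
  assumes \<mu>: "\<And>n. real_distribution (\<mu> n)"
    and int: "\<And>n. integrable (\<mu> n) (\<lambda>x. x ^ 2)"
    and bound: "\<And>n. (\<integral>x. x ^ 2 \<partial>\<mu> n) \<le> C"
  shows "tight \<mu>"
  unfolding tight_def
proof (intro conjI allI impI)
  fix \<epsilon> :: real assume \<epsilon>: "\<epsilon> > 0"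
  \<comment> \<open>With \<open>\<bar>C\<bar> + 1\<close> in place of \<open>C\<close> the number
    \<open>K\<close> is positive for every \<open>C\<close>, and the bound \<open>C / K ^ 2\<close>
    falls strictly below the given tolerance.\<close>
  define K where "K = sqrt ((\<bar>C\<bar> + 1) / \<epsilon>)"
  have K: "K > 0" "K ^ 2 = (\<bar>C\<bar> + 1) / \<epsilon>"
    using \<epsilon> by (auto simp: K_def)
  have "measure (\<mu> n) {-K<..K} > 1 - \<epsilon>" for n
  proof -
    interpret real_distribution "\<mu> n" by (rule \<mu>)
    have "measure (\<mu> n) {x\<in>space (\<mu> n). x ^ 2 \<ge> K ^ 2} \<le> (\<integral>x. x ^ 2 \<partial>\<mu> n) / K ^ 2"
      using int[of n] K(1) by (intro integral_Markov_inequality_measure[where A = "{}"]) auto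
    also have "\<dots> \<le> C / K ^ 2"
      by (intro divide_right_mono bound) auto
    also have "\<dots> < \<epsilon>"
    proof -
      have "C / K ^ 2 = \<epsilon> * (C / (\<bar>C\<bar> + 1))" unfolding K(2) using \<epsilon> by simp
      also have "C / (\<bar>C\<bar> + 1) < 1" by (simp add: divide_less_eq_1_pos)
      hence "\<epsilon> * (C / (\<bar>C\<bar> + 1)) < \<epsilon> * 1" using \<epsilon> by (intro mult_strict_left_mono) auto
      finally show ?thesis by simp
    qed
    finally have *: "prob {x. x ^ 2 \<ge> K ^ 2} < \<epsilon>" by simp
    have "prob (UNIV - {-K<..K}) \<le> prob {x. x ^ 2 \<ge> K ^ 2}"
      using K(1) by (intro finite_measure_mono) (auto simp flip: abs_le_square_iff)
    with * have "prob (UNIV - {-K<..K}) < \<epsilon>" by simp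
    moreover have "prob (UNIV - {-K<..K}) = 1 - prob {-K<..K}"
      using prob_compl[of "{-K<..K}"] by simp
    ultimately show ?thesis by simp
  qed
  thus "\<exists>a b. a < b \<and> (\<forall>n. measure (\<mu> n) {a<..b} > 1 - \<epsilon>)"
    using K by (intro exI[of _ "-K"] exI[of _ K]) auto
qed (use \<mu> in auto)

section \<open>Truncation, and moments under weak convergence\<close>

definition clamp_real :: "real \<Rightarrow> real \<Rightarrow> real" where
  "clamp_real K x = max (- K) (min K x)"

lemma isCont_clamp_real_power: "isCont (\<lambda>x. clamp_real K x ^ r) x"
  unfolding clamp_real_def by (intro continuous_intros)

lemma abs_clamp_real_le: "K \<ge> 0 \<Longrightarrow> \<bar>clamp_real K x\<bar> \<le> K" "K \<ge> 0 \<Longrightarrow> \<bar>clamp_real K x\<bar> \<le> \<bar>x\<bar>"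
  by (auto simp: clamp_real_def)

lemma measurable_clamp_real[measurable]: "clamp_real K \<in> borel_measurable borel"
  unfolding clamp_real_def by measurable

text \<open>There is no error for \<open>\<bar>x\<bar> \<le> K\<close>; beyond that the factor
  \<open>(\<bar>x\<bar> / K) ^ (r + 2)\<close> is at least 1. The exponent \<open>r + 2\<close>
  makes the total power even, so the bound integrates to a plain moment.\<close>

lemma clamp_real_power_error:
  assumes "K > 0"
  shows "\<bar>x ^ r - clamp_real K x ^ r\<bar> \<le> 2 * x ^ (2 * (r + 1)) / K ^ (r + 2)"
proof (cases "\<bar>x\<bar> \<le> K")
  case True
  hence "clamp_real K x = x" by (auto simp: clamp_real_def)
  thus ?thesis
    using assms zero_le_even_power[of "2 * (r + 1)" x] by (simp del: power_Suc mult_Suc_right add_2_eq_Suc')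
next
  case False
  have "\<bar>x ^ r - clamp_real K x ^ r\<bar> \<le> \<bar>x\<bar> ^ r + \<bar>clamp_real K x\<bar> ^ r"
    by (metis abs_triangle_ineq4 power_abs)
  also have "\<dots> \<le> 2 * \<bar>x\<bar> ^ r"
    using abs_clamp_real_le(2)[of K x] assms by (auto intro: power_mono)
  also have "\<bar>x\<bar> ^ r * K ^ (r + 2) \<le> \<bar>x\<bar> ^ r * \<bar>x\<bar> ^ (r + 2)"
    using False assms by (intro mult_left_mono power_mono) auto
  hence "\<bar>x\<bar> ^ r \<le> \<bar>x\<bar> ^ r * \<bar>x\<bar> ^ (r + 2) / K ^ (r + 2)"
    using assms by (simp add: field_simps)
  also have "\<bar>x\<bar> ^ r * \<bar>x\<bar> ^ (r + 2) = x ^ (2 * (r + 1))"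
  proof -
    have "\<bar>x\<bar> ^ r * \<bar>x\<bar> ^ (r + 2) = \<bar>x\<bar> ^ (2 * (r + 1))"
      unfolding power_add[symmetric] by (rule arg_cong[where f = "(^) \<bar>x\<bar>"]) simp
    thus ?thesis by (simp only: power_even_abs even_mult_iff even_numeral simp_thms)
  qed
  finally show ?thesis by simp
qed

lemma integrable_moments_of_even:
  fixes M :: "real measure"
  assumes "real_distribution M" and "integrable M (\<lambda>x. x ^ (2 * r))"
  shows "integrable M (\<lambda>x. x ^ r)"
proof -
  interpret real_distribution M by fact
  show ?thesis
  proof (rule Bochner_Integration.integrable_bound)
    show "integrable M (\<lambda>x. 1 + x ^ (2 * r))" using assms by simp
    have "\<bar>x\<bar> ^ r \<le> 1 + (\<bar>x\<bar> ^ r) ^ 2" for x :: real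
      by (smt (verit) power2_eq_square mult_left_mono zero_le_power abs_ge_zero mult_cancel_left2 zero_le_power2)
    hence "\<bar>x ^ r\<bar> \<le> 1 + x ^ (2 * r)" for x :: real
    proof -
      have "(\<bar>x\<bar> ^ r) ^ 2 = x ^ (2 * r)"
        by (simp add: power2_eq_square power_mult flip: power_mult_distrib)
      thus ?thesis using \<open>\<And>x. \<bar>x\<bar> ^ r \<le> 1 + (\<bar>x\<bar> ^ r) ^ 2\<close>[of x] by (simp add: power_abs)
    qed
    thus "AE x in M. norm (x ^ r) \<le> norm (1 + x ^ (2 * r))"
      by (intro AE_I2) (metis abs_ge_self order_trans real_norm_def)
  qed auto
qed

text \<open>Powers of the clamped variable are bounded and continuous, so their integrals pass to
  the weak limit and stay below \<open>C\<close>. Fatou's lemma then removes the truncation.\<close>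

lemma weak_conv_even_moments_bounded:
  fixes \<mu> :: "nat \<Rightarrow> real measure"
  assumes \<mu>: "\<And>n. real_distribution (\<mu> n)" and M: "real_distribution M" and conv: "weak_conv_m \<mu> M"
    and int: "\<And>n. integrable (\<mu> n) (\<lambda>x. x ^ (2 * r))"
    and bound: "\<And>n. (\<integral>x. x ^ (2 * r) \<partial>\<mu> n) \<le> C"
  shows "integrable M (\<lambda>x. x ^ (2 * r))"
proof -
  interpret M: real_distribution M by fact
  interpret \<mu>: real_distribution "\<mu> n" for n by (rule \<mu>)
  let ?f = "\<lambda>K x. clamp_real (real K) x ^ (2 * r)"
  have bd: "norm (?f K x) \<le> real K ^ (2 * r)" for K x
    using abs_clamp_real_le(1)[of "real K" x] by (simp add: power_abs power_mono)
  have intf: "integrable M (?f K)" "integrable (\<mu> n) (?f K)" for K n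
    using bd by (auto intro!: M.integrable_const_bound[where B = "real K ^ (2 * r)"]
        \<mu>.integrable_const_bound[where B = "real K ^ (2 * r)"])
  have le: "(\<integral>x. ?f K x \<partial>M) \<le> C" for K
  proof (rule LIMSEQ_le_const2)
    show "(\<lambda>n. \<integral>x. ?f K x \<partial>\<mu> n) \<longlonglongrightarrow> (\<integral>x. ?f K x \<partial>M)"
      by (rule weak_conv_imp_integral_bdd_continuous_conv[OF \<mu> M conv isCont_clamp_real_power bd])
    have "(\<integral>x. ?f K x \<partial>\<mu> n) \<le> (\<integral>x. x ^ (2 * r) \<partial>\<mu> n)" for n
    proof (intro integral_mono intf int)
      fix x :: real
      show "?f K x \<le> x ^ (2 * r)"
        using power_mono[OF abs_clamp_real_le(2)[of "real K" x], of "2 * r"] by (simp add: power_even_abs)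
    qed
    thus "\<exists>N. \<forall>n\<ge>N. (\<integral>x. ?f K x \<partial>\<mu> n) \<le> C"
      using bound order_trans by blast
  qed
  have lim: "(\<lambda>K. ?f K x) \<longlonglongrightarrow> x ^ (2 * r)" for x
  proof (rule tendsto_eventually)
    obtain N :: nat where N: "\<bar>x\<bar> \<le> real N" using real_arch_simple by blast
    show "eventually (\<lambda>K. ?f K x = x ^ (2 * r)) sequentially"
      using eventually_ge_at_top[of N]
    proof eventually_elim
      case (elim K)
      hence "clamp_real (real K) x = x" using N by (auto simp: clamp_real_def)
      thus ?case by simp
    qed
  qed
  have "(\<integral>\<^sup>+x. ennreal (x ^ (2 * r)) \<partial>M) = (\<integral>\<^sup>+x. liminf (\<lambda>K. ennreal (?f K x)) \<partial>M)"
    by (intro nn_integral_cong lim_imp_Liminf[symmetric] tendsto_ennrealI lim) auto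
  also have "\<dots> \<le> liminf (\<lambda>K. \<integral>\<^sup>+x. ennreal (?f K x) \<partial>M)"
    by (intro nn_integral_liminf) auto
  also have "\<dots> \<le> liminf (\<lambda>K::nat. ennreal C)"
    by (intro Liminf_mono always_eventually allI)
      (subst nn_integral_eq_integral, auto intro: intf ennreal_leI le simp: zero_le_even_power)
  also have "\<dots> < \<infinity>" by (simp add: Liminf_const)
  finally show ?thesis
    by (intro integrableI_nonneg) (auto simp: zero_le_even_power)
qed

text \<open>The bound on moments of order \<open>2 * (r + 1)\<close> makes the truncation error
  small uniformly in \<open>n\<close>, so the limit in \<open>n\<close> can be taken for the
  truncated powers.\<close>

lemma weak_conv_moments:
  fixes \<mu> :: "nat \<Rightarrow> real measure"
  assumes \<mu>: "\<And>n. real_distribution (\<mu> n)" and M: "real_distribution M" and conv: "weak_conv_m \<mu> M"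
    and int: "\<And>n r. integrable (\<mu> n) (\<lambda>x. x ^ r)"
    and bound: "\<And>n r. (\<integral>x. x ^ (2 * r) \<partial>\<mu> n) \<le> C r"
  shows "integrable M (\<lambda>x. x ^ r)"
    and "(\<lambda>n. \<integral>x. x ^ r \<partial>\<mu> n) \<longlonglongrightarrow> (\<integral>x. x ^ r \<partial>M)"
proof -
  interpret M: real_distribution M by fact
  interpret \<mu>: real_distribution "\<mu> n" for n by (rule \<mu>)
  have intM: "integrable M (\<lambda>x. x ^ r)" for r
    using weak_conv_even_moments_bounded[OF \<mu> M conv int bound] M
    by (blast intro: integrable_moments_of_even)
  show "integrable M (\<lambda>x. x ^ r)" by (rule intM)
  \<comment> \<open>One constant for the sequence and its limit, so that a single truncation level
    \<open>K\<close> serves both in the three-part estimate below.\<close>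
  define B where "B = max (C (r + 1)) (\<integral>x. x ^ (2 * (r + 1)) \<partial>M)"
  have B0: "B \<ge> 0"
    unfolding B_def by (intro max.coboundedI2 integral_nonneg_AE) (auto intro!: AE_I2 zero_le_even_power simp del: power_Suc mult_Suc_right)
  have trunc: "\<bar>(\<integral>x. x ^ r \<partial>N) - (\<integral>x. clamp_real K x ^ r \<partial>N)\<bar> \<le> 2 * B / K ^ (r + 2)"
    if N: "real_distribution N" and iN: "\<And>r. integrable N (\<lambda>x. x ^ r)"
      and bN: "(\<integral>x. x ^ (2 * (r + 1)) \<partial>N) \<le> B" and K: "K > 0" for N K
  proof -
    interpret N: real_distribution N by fact
    have ic: "integrable N (\<lambda>x. clamp_real K x ^ r)"
      using abs_clamp_real_le(1)[of K] K
      by (intro N.integrable_const_bound[where B = "K ^ r"]) (auto simp: power_abs power_mono)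
    have "\<bar>(\<integral>x. x ^ r \<partial>N) - (\<integral>x. clamp_real K x ^ r \<partial>N)\<bar> = \<bar>\<integral>x. x ^ r - clamp_real K x ^ r \<partial>N\<bar>"
      using ic iN by simp
    also have "\<dots> \<le> (\<integral>x. \<bar>x ^ r - clamp_real K x ^ r\<bar> \<partial>N)"
      by (rule integral_abs_bound)
    also have "\<dots> \<le> (\<integral>x. 2 * x ^ (2 * (r + 1)) / K ^ (r + 2) \<partial>N)"
      by (intro integral_mono integrable_abs Bochner_Integration.integrable_diff
          integrable_divide integrable_mult_right ic iN clamp_real_power_error[OF K])
    also have "\<dots> = 2 * (\<integral>x. x ^ (2 * (r + 1)) \<partial>N) / K ^ (r + 2)"
      by simp
    also have "\<dots> \<le> 2 * B / K ^ (r + 2)"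
      using bN K by (intro divide_right_mono mult_left_mono) auto
    finally show ?thesis .
  qed
  show "(\<lambda>n. \<integral>x. x ^ r \<partial>\<mu> n) \<longlonglongrightarrow> (\<integral>x. x ^ r \<partial>M)"
  proof (rule LIMSEQ_I)
    fix e :: real assume e: "e > 0"
    have "(\<lambda>K. 2 * B / real K ^ (r + 2)) \<longlonglongrightarrow> 0"
      by real_asymp
    hence "eventually (\<lambda>K. 2 * B / real K ^ (r + 2) < e / 3) sequentially"
      using e by (intro order_tendstoD) auto
    hence "eventually (\<lambda>K::nat. K > 0 \<and> 2 * B / real K ^ (r + 2) < e / 3) sequentially"
      using eventually_gt_at_top[of 0] by eventually_elim auto
    then obtain K :: nat where K: "K > 0" "2 * B / real K ^ (r + 2) < e / 3"
      by (auto dest: eventually_happens)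
    let ?c = "\<lambda>x. clamp_real (real K) x ^ r"
    have "(\<lambda>n. \<integral>x. ?c x \<partial>\<mu> n) \<longlonglongrightarrow> (\<integral>x. ?c x \<partial>M)"
      using abs_clamp_real_le(1)[of "real K"]
      by (intro weak_conv_imp_integral_bdd_continuous_conv[OF \<mu> M conv isCont_clamp_real_power, where B = "real K ^ r"])
        (auto simp: power_abs power_mono)
    then obtain n0 where n0: "\<And>n. n \<ge> n0 \<Longrightarrow> \<bar>(\<integral>x. ?c x \<partial>\<mu> n) - (\<integral>x. ?c x \<partial>M)\<bar> < e / 3"
      using e LIMSEQ_D[of _ _ "e/3"] by (metis divide_pos_pos real_norm_def zero_less_numeral)
    have "\<bar>(\<integral>x. x ^ r \<partial>\<mu> n) - (\<integral>x. x ^ r \<partial>M)\<bar> < e" if "n \<ge> n0" for n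
    proof -
      have "\<bar>(\<integral>x. x ^ r \<partial>\<mu> n) - (\<integral>x. ?c x \<partial>\<mu> n)\<bar> \<le> 2 * B / real K ^ (r + 2)"
        using bound[where r = "r + 1" and n = n] K unfolding B_def
        by (intro trunc[OF \<mu> int, unfolded B_def] max.coboundedI1) auto
      moreover have "\<bar>(\<integral>x. x ^ r \<partial>M) - (\<integral>x. ?c x \<partial>M)\<bar> \<le> 2 * B / real K ^ (r + 2)"
        using K unfolding B_def by (intro trunc[OF M intM, unfolded B_def] max.cobounded2) auto
      ultimately show ?thesis using n0[OF that] K(2) by linarith
    qed
    thus "\<exists>no. \<forall>n\<ge>no. norm ((\<integral>x. x ^ r \<partial>\<mu> n) - (\<integral>x. x ^ r \<partial>M)) < e" by auto
  qed
qed

section \<open>Determinacy through characteristic functions\<close>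

text \<open>The Taylor remainder is controlled by an absolute moment of the same order. Only even
  orders are used, for which this is an ordinary moment and \<open>growth\<close> applies.\<close>

lemma char_taylor_even_LIMSEQ:
  fixes M :: "real measure" and t :: real
  assumes "real_distribution M" and int: "\<And>r. integrable M (\<lambda>x. x ^ r)"
    and growth: "(\<lambda>k. t ^ (2 * k) * (\<integral>x. x ^ (2 * k) \<partial>M) / fact (2 * k)) \<longlonglongrightarrow> 0"
  shows "(\<lambda>n. \<Sum>k\<le>2 * n. (\<i> * t) ^ k / fact k * complex_of_real (\<integral>x. x ^ k \<partial>M)) \<longlonglongrightarrow> char M t"
proof -
  interpret real_distribution M by fact
  have "(\<lambda>n. char M t - (\<Sum>k\<le>2 * n. (\<i> * t) ^ k / fact k * complex_of_real (\<integral>x. x ^ k \<partial>M))) \<longlonglongrightarrow> 0"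
  proof (rule Lim_null_comparison)
    show "(\<lambda>n. 2 * (t ^ (2 * n) * (\<integral>x. x ^ (2 * n) \<partial>M) / fact (2 * n))) \<longlonglongrightarrow> 0"
      using tendsto_mult_right_zero[OF growth] by simp
    show "\<forall>\<^sub>F n in sequentially. cmod (char M t - (\<Sum>k\<le>2 * n. (\<i> * t) ^ k / fact k * complex_of_real (\<integral>x. x ^ k \<partial>M)))
        \<le> 2 * (t ^ (2 * n) * (\<integral>x. x ^ (2 * n) \<partial>M) / fact (2 * n))"
    proof (intro always_eventually allI)
      fix n
      show "cmod (char M t - (\<Sum>k\<le>2 * n. (\<i> * t) ^ k / fact k * complex_of_real (\<integral>x. x ^ k \<partial>M)))
          \<le> 2 * (t ^ (2 * n) * (\<integral>x. x ^ (2 * n) \<partial>M) / fact (2 * n))"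
        using char_approx1[OF int, where n = "2 * n" and t = t] by (simp add: power_even_abs)
    qed
  qed
  from tendsto_diff[OF tendsto_const[of "char M t"] this] show ?thesis by simp
qed

text \<open>Equal moments give equal Taylor polynomials, so both characteristic functions are the
  limit of the same sequence.\<close>

theorem moments_determine_distribution:
  fixes M M' :: "real measure"
  assumes "real_distribution M" "real_distribution M'"
    and "\<And>r. integrable M (\<lambda>x. x ^ r)" "\<And>r. integrable M' (\<lambda>x. x ^ r)"
    and eq: "\<And>r. (\<integral>x. x ^ r \<partial>M') = (\<integral>x. x ^ r \<partial>M)"
    and growth: "\<And>t. (\<lambda>k. t ^ (2 * k) * (\<integral>x. x ^ (2 * k) \<partial>M) / fact (2 * k)) \<longlonglongrightarrow> 0"
  shows "M' = M"
proof (rule Levy_uniqueness)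
  show "char M' = char M"
  proof
    fix t :: real
    show "char M' t = char M t"
      using char_taylor_even_LIMSEQ[where M = M and t = t] char_taylor_even_LIMSEQ[where M = M' and t = t] assms
      by (intro LIMSEQ_unique[of _ "char M' t" "char M t"]) (simp_all add: eq)
  qed
qed fact+

text \<open>Bounded second moments give tightness. Every weak subsequential limit has the moments
  \<open>m\<close>, and these determine it, so all such limits coincide and the whole sequence
  converges.\<close>

theorem method_of_moments:
  fixes \<mu> :: "nat \<Rightarrow> real measure" and m :: "nat \<Rightarrow> real"
  assumes \<mu>: "\<And>n. real_distribution (\<mu> n)"
    and int: "\<And>n r. integrable (\<mu> n) (\<lambda>x. x ^ r)"
    and lim: "\<And>r. (\<lambda>n. \<integral>x. x ^ r \<partial>\<mu> n) \<longlonglongrightarrow> m r"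
    and growth: "\<And>t. (\<lambda>k. t ^ (2 * k) * m (2 * k) / fact (2 * k)) \<longlonglongrightarrow> 0"
  obtains M where "real_distribution M" "\<And>r. integrable M (\<lambda>x. x ^ r)"
    "\<And>r. (\<integral>x. x ^ r \<partial>M) = m r" "weak_conv_m \<mu> M"
proof -
  have "\<exists>C. \<forall>n. (\<integral>x. x ^ (2 * r) \<partial>\<mu> n) \<le> C" for r
    using convergent_imp_Bseq[OF convergentI[OF lim[of "2 * r"]]] unfolding Bseq_def
    by (metis abs_le_D1 real_norm_def)
  then obtain C where C: "\<And>n r. (\<integral>x. x ^ (2 * r) \<partial>\<mu> n) \<le> C r" by metis
  have tight: "tight \<mu>"
    using C[where r = 1] int by (intro tight_if_second_moments_bounded[OF \<mu>, where C = "C 1"]) auto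
  have sub: "integrable \<nu> (\<lambda>x. x ^ r) \<and> (\<integral>x. x ^ r \<partial>\<nu>) = m r"
    if s: "strict_mono s" and \<nu>: "real_distribution \<nu>" "weak_conv_m (\<mu> \<circ> s) \<nu>" for s \<nu> r
  proof
    have *: "real_distribution ((\<mu> \<circ> s) n)" "integrable ((\<mu> \<circ> s) n) (\<lambda>x. x ^ r)"
      "(\<integral>x. x ^ (2 * r) \<partial>(\<mu> \<circ> s) n) \<le> C r" for n r
      using \<mu> int C by auto
    show "integrable \<nu> (\<lambda>x. x ^ r)"
      by (rule weak_conv_moments(1)[OF *(1) \<nu> *(2,3)])
    show "(\<integral>x. x ^ r \<partial>\<nu>) = m r"
      using weak_conv_moments(2)[OF *(1) \<nu> *(2,3), of r] LIMSEQ_subseq_LIMSEQ[OF lim s, of r]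
      by (intro LIMSEQ_unique[of _ "\<integral>x. x ^ r \<partial>\<nu>" "m r"]) (simp_all add: o_def)
  qed
  obtain s M where s: "strict_mono (s :: nat \<Rightarrow> nat)" and M: "real_distribution M" "weak_conv_m (\<mu> \<circ> id \<circ> s) M"
    using tight_imp_convergent_subsubsequence[OF tight, of id] by (auto simp: strict_mono_def)
  have momM: "integrable M (\<lambda>x. x ^ r)" "(\<integral>x. x ^ r \<partial>M) = m r" for r
    using sub[OF s M(1)] M(2) by auto
  have "weak_conv_m \<mu> M"
  proof (rule tight_subseq_weak_converge[OF \<mu> M(1) tight])
    fix s \<nu> assume *: "strict_mono (s :: nat \<Rightarrow> nat)" "real_distribution \<nu>" "weak_conv_m (\<mu> \<circ> s) \<nu>"
    have "\<nu> = M"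
      using sub[OF *] momM growth by (intro moments_determine_distribution M(1) *(2)) auto
    with * show "weak_conv_m (\<mu> \<circ> s) M" by simp
  qed
  with that M(1) momM show thesis by blast
qed

section \<open>The Markov chain of sink edges\<close>

definition sink_edges_a :: "network \<Rightarrow> nat" where
  "sink_edges_a G = length (filter (\<lambda>e. snd e = sp_sink \<and> outdeg G (fst e) = 1) G)"

text \<open>The test is \<open>\<noteq> 1\<close> rather than \<open>= 2\<close>, to match the
  branching in \<open>sp_step\<close>; the two counts thus partition the sink edges of an arbitrary
  list.\<close>

definition sink_edges_b :: "network \<Rightarrow> nat" where
  "sink_edges_b G = length (filter (\<lambda>e. snd e = sp_sink \<and> outdeg G (fst e) \<noteq> 1) G)"

lemma indeg_sink_eq: "indeg G sp_sink = sink_edges_a G + sink_edges_b G"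
proof -
  have "length (filter (\<lambda>e. snd e = sp_sink) xs) =
      length (filter (\<lambda>e. snd e = sp_sink \<and> P e) xs) +
      length (filter (\<lambda>e. snd e = sp_sink \<and> \<not> P e) xs)" for P and xs :: network
    by (induction xs) auto
  thus ?thesis by (simp add: indeg_def sink_edges_a_def sink_edges_b_def)
qed

section \<open>Effect of one growth step on the two counts\<close>

lemma fresh_vertex_fresh:
  assumes "e \<in> set G"
  shows "fst e < fresh_vertex G" "snd e < fresh_vertex G"
  using assms by (auto simp: fresh_vertex_def less_Suc_eq_le intro!: Max_ge)

lemma sink_less_fresh_vertex: "sp_sink < fresh_vertex G"
  by (auto simp: fresh_vertex_def less_Suc_eq_le intro!: Max_ge)

lemma sp_step_split:
  assumes "i < length G"
  obtains xs x y ys where "G = xs @ (x, y) # ys" "G ! i = (x, y)"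
    "sp_step G i = (if outdeg G x = 1 then xs @ (x, y) # ys @ [(x, y)]
       else xs @ (x, fresh_vertex G) # ys @ [(fresh_vertex G, y)])"
proof -
  obtain x y where xy: "G ! i = (x, y)" by (cases "G ! i")
  have G: "G = take i G @ (x, y) # drop (Suc i) G"
    using id_take_nth_drop[OF assms] xy by simp
  have "G[i := (x, z)] = take i G @ (x, z) # drop (Suc i) G" for z
    by (rule upd_conv_take_nth_drop[OF assms])
  hence "sp_step G i = (if outdeg G x = 1 then take i G @ (x, y) # drop (Suc i) G @ [(x, y)]
       else take i G @ (x, fresh_vertex G) # drop (Suc i) G @ [(fresh_vertex G, y)])"
    using G by (auto simp: sp_step_def xy Let_def)
  with G xy that show thesis by metis
qed

text \<open>The chosen edge is the only one leaving its tail, so raising that out-degree to 2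
  changes the type of no other edge. If it enters the sink, it and its copy both count as type
  \<open>b\<close> afterwards.\<close>

lemma sink_edges_step_parallel:
  assumes i: "i < length G" and out: "outdeg G (fst (G ! i)) = 1"
  shows "snd (G ! i) = sp_sink \<Longrightarrow> sink_edges_a (sp_step G i) = sink_edges_a G - 1"
    and "snd (G ! i) = sp_sink \<Longrightarrow> sink_edges_b (sp_step G i) = sink_edges_b G + 2"
    and "snd (G ! i) \<noteq> sp_sink \<Longrightarrow> sink_edges_a (sp_step G i) = sink_edges_a G"
    and "snd (G ! i) \<noteq> sp_sink \<Longrightarrow> sink_edges_b (sp_step G i) = sink_edges_b G"
proof -
  obtain xs x y ys where G: "G = xs @ (x, y) # ys" and xy: "G ! i = (x, y)"
    and step: "sp_step G i = (if outdeg G x = 1 then xs @ (x, y) # ys @ [(x, y)]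
       else xs @ (x, fresh_vertex G) # ys @ [(fresh_vertex G, y)])"
    by (rule sp_step_split[OF i])
  define H where "H = xs @ (x, y) # ys @ [(x, y)]"
  have H: "sp_step G i = H" using out by (simp add: step xy H_def)
  have "filter (\<lambda>e. fst e = x) xs = [] \<and> filter (\<lambda>e. fst e = x) ys = []"
    using out unfolding xy unfolding G by (simp add: outdeg_def)
  hence no: "\<And>e. e \<in> set xs \<union> set ys \<Longrightarrow> fst e \<noteq> x" by (auto simp: filter_empty_conv)
  have out_H: "outdeg H v = outdeg G v + (if v = x then 1 else 0)" for v
    by (simp add: outdeg_def G H_def)
  have a: "filter (\<lambda>e. snd e = sp_sink \<and> outdeg H (fst e) = 1) zs =
      filter (\<lambda>e. snd e = sp_sink \<and> outdeg G (fst e) = 1) zs"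
   and b: "filter (\<lambda>e. snd e = sp_sink \<and> outdeg H (fst e) \<noteq> 1) zs =
      filter (\<lambda>e. snd e = sp_sink \<and> outdeg G (fst e) \<noteq> 1) zs"
    if "set zs \<subseteq> set xs \<union> set ys" for zs
    using that no by (intro filter_cong refl; auto simp: out_H)+
  have x: "outdeg H x = 2" "outdeg G x = 1" using out by (auto simp: out_H xy)
  have a': "sink_edges_a H = length (filter (\<lambda>e. snd e = sp_sink \<and> outdeg G (fst e) = 1) xs) +
      length (filter (\<lambda>e. snd e = sp_sink \<and> outdeg G (fst e) = 1) ys)"
  proof -
    have "sink_edges_a H = length (filter (\<lambda>e. snd e = sp_sink \<and> outdeg H (fst e) = 1) (xs @ (x, y) # ys @ [(x, y)]))"
      unfolding sink_edges_a_def H_def ..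
    thus ?thesis using a[of xs] a[of ys] x by simp
  qed
  have b': "sink_edges_b H = length (filter (\<lambda>e. snd e = sp_sink \<and> outdeg G (fst e) \<noteq> 1) xs) +
      length (filter (\<lambda>e. snd e = sp_sink \<and> outdeg G (fst e) \<noteq> 1) ys) + (if y = sp_sink then 2 else 0)"
  proof -
    have "sink_edges_b H = length (filter (\<lambda>e. snd e = sp_sink \<and> outdeg H (fst e) \<noteq> 1) (xs @ (x, y) # ys @ [(x, y)]))"
      unfolding sink_edges_b_def H_def ..
    thus ?thesis using b[of xs] b[of ys] x by simp
  qed
  have aG: "sink_edges_a G = length (filter (\<lambda>e. snd e = sp_sink \<and> outdeg G (fst e) = 1) xs) +
      length (filter (\<lambda>e. snd e = sp_sink \<and> outdeg G (fst e) = 1) ys) + (if y = sp_sink then 1 else 0)"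
  proof -
    have "sink_edges_a G = length (filter (\<lambda>e. snd e = sp_sink \<and> outdeg G (fst e) = 1) (xs @ (x, y) # ys))"
      unfolding sink_edges_a_def by (rule arg_cong[OF G, of "\<lambda>zs. length (filter _ zs)"])
    thus ?thesis using x by simp
  qed
  have bG: "sink_edges_b G = length (filter (\<lambda>e. snd e = sp_sink \<and> outdeg G (fst e) \<noteq> 1) xs) +
      length (filter (\<lambda>e. snd e = sp_sink \<and> outdeg G (fst e) \<noteq> 1) ys)"
  proof -
    have "sink_edges_b G = length (filter (\<lambda>e. snd e = sp_sink \<and> outdeg G (fst e) \<noteq> 1) (xs @ (x, y) # ys))"
      unfolding sink_edges_b_def by (rule arg_cong[OF G, of "\<lambda>zs. length (filter _ zs)"])
    thus ?thesis using x by simp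
  qed
  show "snd (G ! i) = sp_sink \<Longrightarrow> sink_edges_a (sp_step G i) = sink_edges_a G - 1"
    "snd (G ! i) = sp_sink \<Longrightarrow> sink_edges_b (sp_step G i) = sink_edges_b G + 2"
    "snd (G ! i) \<noteq> sp_sink \<Longrightarrow> sink_edges_a (sp_step G i) = sink_edges_a G"
    "snd (G ! i) \<noteq> sp_sink \<Longrightarrow> sink_edges_b (sp_step G i) = sink_edges_b G"
    unfolding H xy a' b' aG bG by simp_all
qed

text \<open>The out-degree of \<open>x\<close> is unchanged since its edge is only redirected, and
  the new vertex has out-degree 1. So an edge of type \<open>b\<close> into the sink gives way to
  one of type \<open>a\<close>.\<close>

lemma sink_edges_step_series:
  assumes i: "i < length G" and out: "outdeg G (fst (G ! i)) \<noteq> 1"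
  shows "snd (G ! i) = sp_sink \<Longrightarrow> sink_edges_a (sp_step G i) = sink_edges_a G + 1"
    and "snd (G ! i) = sp_sink \<Longrightarrow> sink_edges_b (sp_step G i) = sink_edges_b G - 1"
    and "snd (G ! i) \<noteq> sp_sink \<Longrightarrow> sink_edges_a (sp_step G i) = sink_edges_a G"
    and "snd (G ! i) \<noteq> sp_sink \<Longrightarrow> sink_edges_b (sp_step G i) = sink_edges_b G"
proof -
  define z where "z = fresh_vertex G"
  obtain xs x y ys where G: "G = xs @ (x, y) # ys" and xy: "G ! i = (x, y)"
    and step: "sp_step G i = (if outdeg G x = 1 then xs @ (x, y) # ys @ [(x, y)]
       else xs @ (x, z) # ys @ [(z, y)])"
    unfolding z_def by (rule sp_step_split[OF i])
  define H where "H = xs @ (x, z) # ys @ [(z, y)]"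
  have H: "sp_step G i = H" using out by (simp add: step xy H_def)
  have fresh: "\<And>e. e \<in> set G \<Longrightarrow> fst e \<noteq> z"
    using fresh_vertex_fresh[of _ G] unfolding z_def by (metis less_irrefl)
  have "x \<noteq> z" using fresh[of "(x, y)"] by (simp add: G)
  \<comment> \<open>Without this the redirected edge \<open>(x, z)\<close> could itself be a sink
    edge.\<close>
  have "z \<noteq> sp_sink" using sink_less_fresh_vertex[of G] by (simp add: z_def)
  have no: "filter (\<lambda>e. fst e = z) zs = []" if "set zs \<subseteq> set G" for zs
    using fresh that by (auto simp: filter_empty_conv)
  have out_H: "outdeg H v = (if v = z then 1 else outdeg G v)" for v
    using \<open>x \<noteq> z\<close> no[of xs] no[of ys] by (auto simp: outdeg_def G H_def)
  have a: "filter (\<lambda>e. snd e = sp_sink \<and> outdeg H (fst e) = 1) zs =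
      filter (\<lambda>e. snd e = sp_sink \<and> outdeg G (fst e) = 1) zs"
   and b: "filter (\<lambda>e. snd e = sp_sink \<and> outdeg H (fst e) \<noteq> 1) zs =
      filter (\<lambda>e. snd e = sp_sink \<and> outdeg G (fst e) \<noteq> 1) zs"
    if "set zs \<subseteq> set G" for zs
    using that fresh by (intro filter_cong refl; auto simp: out_H)+
  have x: "outdeg H z = 1" "outdeg G x \<noteq> 1" using out by (auto simp: out_H xy)
  have sub: "set xs \<subseteq> set G" "set ys \<subseteq> set G" by (auto simp: G)
  have a': "sink_edges_a H = length (filter (\<lambda>e. snd e = sp_sink \<and> outdeg G (fst e) = 1) xs) +
      length (filter (\<lambda>e. snd e = sp_sink \<and> outdeg G (fst e) = 1) ys) + (if y = sp_sink then 1 else 0)"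
  proof -
    have "sink_edges_a H = length (filter (\<lambda>e. snd e = sp_sink \<and> outdeg H (fst e) = 1) (xs @ (x, z) # ys @ [(z, y)]))"
      unfolding sink_edges_a_def H_def ..
    thus ?thesis using a[OF sub(1)] a[OF sub(2)] x \<open>z \<noteq> sp_sink\<close> by simp
  qed
  have b': "sink_edges_b H = length (filter (\<lambda>e. snd e = sp_sink \<and> outdeg G (fst e) \<noteq> 1) xs) +
      length (filter (\<lambda>e. snd e = sp_sink \<and> outdeg G (fst e) \<noteq> 1) ys)"
  proof -
    have "sink_edges_b H = length (filter (\<lambda>e. snd e = sp_sink \<and> outdeg H (fst e) \<noteq> 1) (xs @ (x, z) # ys @ [(z, y)]))"
      unfolding sink_edges_b_def H_def ..
    thus ?thesis using b[OF sub(1)] b[OF sub(2)] x \<open>z \<noteq> sp_sink\<close> by simp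
  qed
  have aG: "sink_edges_a G = length (filter (\<lambda>e. snd e = sp_sink \<and> outdeg G (fst e) = 1) xs) +
      length (filter (\<lambda>e. snd e = sp_sink \<and> outdeg G (fst e) = 1) ys)"
  proof -
    have "sink_edges_a G = length (filter (\<lambda>e. snd e = sp_sink \<and> outdeg G (fst e) = 1) (xs @ (x, y) # ys))"
      unfolding sink_edges_a_def by (rule arg_cong[OF G, of "\<lambda>zs. length (filter _ zs)"])
    thus ?thesis using x by simp
  qed
  have bG: "sink_edges_b G = length (filter (\<lambda>e. snd e = sp_sink \<and> outdeg G (fst e) \<noteq> 1) xs) +
      length (filter (\<lambda>e. snd e = sp_sink \<and> outdeg G (fst e) \<noteq> 1) ys) + (if y = sp_sink then 1 else 0)"
  proof -
    have "sink_edges_b G = length (filter (\<lambda>e. snd e = sp_sink \<and> outdeg G (fst e) \<noteq> 1) (xs @ (x, y) # ys))"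
      unfolding sink_edges_b_def by (rule arg_cong[OF G, of "\<lambda>zs. length (filter _ zs)"])
    thus ?thesis using x by simp
  qed
  show "snd (G ! i) = sp_sink \<Longrightarrow> sink_edges_a (sp_step G i) = sink_edges_a G + 1"
    "snd (G ! i) = sp_sink \<Longrightarrow> sink_edges_b (sp_step G i) = sink_edges_b G - 1"
    "snd (G ! i) \<noteq> sp_sink \<Longrightarrow> sink_edges_a (sp_step G i) = sink_edges_a G"
    "snd (G ! i) \<noteq> sp_sink \<Longrightarrow> sink_edges_b (sp_step G i) = sink_edges_b G"
    unfolding H xy a' b' aG bG by simp_all
qed

lemma length_sp_step: "length (sp_step G i) = Suc (length G)"
  by (simp add: sp_step_def Let_def split: prod.splits)

text \<open>Time is scaled so that every edge is chosen at rate 1.\<close>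

definition sink_generator :: "(nat \<Rightarrow> nat \<Rightarrow> real) \<Rightarrow> nat \<Rightarrow> nat \<Rightarrow> real" where
  "sink_generator f a b = real a * (f (a - 1) (b + 2) - f a b) + real b * (f (a + 1) (b - 1) - f a b)"

text \<open>Divided by \<open>length G\<close> this is the conditional mean after one step. It
  depends on \<open>G\<close> only through its length and the two counts, which is the Markov
  property.\<close>

lemma sum_sink_edges_step:
  "(\<Sum>i<length G. f (sink_edges_a (sp_step G i)) (sink_edges_b (sp_step G i))) =
    real (length G) * f (sink_edges_a G) (sink_edges_b G) +
    sink_generator f (sink_edges_a G) (sink_edges_b G)"
proof -
  define a b where "a = sink_edges_a G" and "b = sink_edges_b G"
  \<comment> \<open>The indices of the sink edges of either type; their cardinalities turn into the
    jump rates \<open>a\<close> and \<open>b\<close> of the generator.\<close>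
  define A where "A = {i. i < length G \<and> snd (G ! i) = sp_sink \<and> outdeg G (fst (G ! i)) = 1}"
  define B where "B = {i. i < length G \<and> snd (G ! i) = sp_sink \<and> outdeg G (fst (G ! i)) \<noteq> 1}"
  have "(\<Sum>i<length G. f (sink_edges_a (sp_step G i)) (sink_edges_b (sp_step G i))) =
      (\<Sum>i<length G. f a b + (if i \<in> A then f (a - 1) (b + 2) - f a b else 0)
        + (if i \<in> B then f (a + 1) (b - 1) - f a b else 0))"
  proof (rule sum.cong[OF refl])
    fix i assume "i \<in> {..<length G}"
    thus "f (sink_edges_a (sp_step G i)) (sink_edges_b (sp_step G i)) =
        f a b + (if i \<in> A then f (a - 1) (b + 2) - f a b else 0)
        + (if i \<in> B then f (a + 1) (b - 1) - f a b else 0)"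
      using sink_edges_step_parallel[of i G] sink_edges_step_series[of i G]
      by (cases "snd (G ! i) = sp_sink"; cases "outdeg G (fst (G ! i)) = 1")
        (simp_all add: a_def b_def A_def B_def)
  qed
  also have "\<dots> = real (length G) * f a b + real (card A) * (f (a - 1) (b + 2) - f a b)
      + real (card B) * (f (a + 1) (b - 1) - f a b)"
  proof -
    have "{..<length G} \<inter> A = A" "{..<length G} \<inter> B = B" by (auto simp: A_def B_def)
    thus ?thesis by (simp add: sum.distrib flip: sum.inter_restrict)
  qed
  also have "card A = a"
    by (simp add: A_def a_def sink_edges_a_def length_filter_conv_card)
  also have "card B = b"
    by (simp add: B_def b_def sink_edges_b_def length_filter_conv_card)
  finally show ?thesis by (simp add: sink_generator_def a_def b_def)
qed

lemma length_sp_net_aux: "G \<in> set_pmf (sp_net_aux k) \<Longrightarrow> length G = Suc k"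
proof (induction k arbitrary: G)
  case (Suc k)
  then obtain G' where G': "G' \<in> set_pmf (sp_net_aux k)"
      "G \<in> sp_step G' ` set_pmf (pmf_of_set {..<length G'})" by auto
  thus ?case using Suc.IH[of G'] by (auto simp: length_sp_step)
qed simp

lemma finite_sp_net_aux: "finite (set_pmf (sp_net_aux k))"
proof (induction k)
  case (Suc k)
  \<comment> \<open>The support of \<open>pmf_of_set\<close> is known only for a finite nonempty
    set, hence the appeal to the positive length of \<open>G\<close>.\<close>
  have "set_pmf (pmf_of_set {..<length G}) = {..<length G}" if "G \<in> set_pmf (sp_net_aux k)" for G
    using length_sp_net_aux[OF that] by (intro set_pmf_of_set) (auto simp: lessThan_empty_iff)
  with Suc show ?case by simp
qed simp

section \<open>Expectations of functions of the two counts\<close>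

text \<open>The index follows \<open>sp_net_aux\<close>: \<open>k\<close> refers to networks with
  \<open>k + 1\<close> edges, so statements about size \<open>n\<close> use
  \<open>n - 1\<close>.\<close>

definition sink_expectation :: "nat \<Rightarrow> (nat \<Rightarrow> nat \<Rightarrow> real) \<Rightarrow> real" where
  "sink_expectation k f =
    measure_pmf.expectation (sp_net_aux k) (\<lambda>G. f (sink_edges_a G) (sink_edges_b G))"

lemma integrable_sp_net_aux: "integrable (measure_pmf (sp_net_aux k)) (f :: network \<Rightarrow> real)"
  by (intro integrable_measure_pmf_finite finite_sp_net_aux)

lemma sink_expectation_add:
    "sink_expectation k (\<lambda>a b. f a b + g a b) = sink_expectation k f + sink_expectation k g"
  and sink_expectation_diff:
    "sink_expectation k (\<lambda>a b. f a b - g a b) = sink_expectation k f - sink_expectation k g"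
  and sink_expectation_cmult:
    "sink_expectation k (\<lambda>a b. c * f a b) = c * sink_expectation k f"
  by (simp_all add: sink_expectation_def integrable_sp_net_aux)

lemma sink_expectation_const: "sink_expectation k (\<lambda>a b. c) = c"
  by (simp add: sink_expectation_def)

lemma sink_expectation_mono:
  "(\<And>a b. f a b \<le> g a b) \<Longrightarrow> sink_expectation k f \<le> sink_expectation k g"
  unfolding sink_expectation_def by (intro integral_mono integrable_sp_net_aux)

lemma sink_expectation_abs_le:
  "\<bar>sink_expectation k f\<bar> \<le> sink_expectation k (\<lambda>a b. \<bar>f a b\<bar>)"
  unfolding sink_expectation_def by (rule integral_abs_bound)

lemma sink_expectation_0: "sink_expectation 0 f = f 1 0"
  by (simp add: sink_expectation_def sink_edges_a_def sink_edges_b_def outdeg_def)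

text \<open>Conditioning on the network with \<open>Suc k\<close> edges, each of which is chosen
  with probability \<open>1 / Suc k\<close>.\<close>

lemma sink_expectation_Suc:
  "sink_expectation (Suc k) f = sink_expectation k f + sink_expectation k (sink_generator f) / real (Suc k)"
proof -
  let ?g = "\<lambda>G. f (sink_edges_a G) (sink_edges_b G)"
  have inner: "measure_pmf.expectation (map_pmf (sp_step G) (pmf_of_set {..<length G})) ?g =
      ?g G + sink_generator f (sink_edges_a G) (sink_edges_b G) / real (Suc k)"
    if "G \<in> set_pmf (sp_net_aux k)" for G
  proof -
    have len: "length G = Suc k" by (rule length_sp_net_aux[OF that])
    have "measure_pmf.expectation (map_pmf (sp_step G) (pmf_of_set {..<length G})) ?g =
        (\<Sum>i<length G. ?g (sp_step G i)) / real (length G)"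
      using len by (subst integral_map_pmf, subst integral_pmf_of_set) auto
    also have "\<dots> = ?g G + sink_generator f (sink_edges_a G) (sink_edges_b G) / real (length G)"
      unfolding sum_sink_edges_step using len by (simp add: add_divide_distrib)
    finally show ?thesis by (simp only: len)
  qed
  have "sink_expectation (Suc k) f = (\<Sum>G\<in>set_pmf (sp_net_aux k). pmf (sp_net_aux k) G *
      measure_pmf.expectation (map_pmf (sp_step G) (pmf_of_set {..<length G})) ?g)"
    unfolding sink_expectation_def sp_net_aux.simps using length_sp_net_aux
    by (subst pmf_expectation_bind[of "set_pmf (sp_net_aux k)"])
      (auto simp: finite_sp_net_aux set_pmf_of_set lessThan_empty_iff)
  also have "\<dots> = (\<Sum>G\<in>set_pmf (sp_net_aux k). pmf (sp_net_aux k) G *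
      (?g G + sink_generator f (sink_edges_a G) (sink_edges_b G) / real (Suc k)))"
    by (intro sum.cong refl arg_cong2[where f = "(*)"] inner)
  also have "\<dots> = measure_pmf.expectation (sp_net_aux k)
      (\<lambda>G. ?g G + sink_generator f (sink_edges_a G) (sink_edges_b G) / real (Suc k))"
    by (subst integral_measure_pmf[OF finite_sp_net_aux[of k]]) auto
  also have "\<dots> = sink_expectation k f + sink_expectation k (sink_generator f) / real (Suc k)"
    by (simp add: sink_expectation_def integrable_sp_net_aux)
  finally show ?thesis .
qed

section \<open>Eigenfunctions of the generator\<close>

definition sink_exponent :: real (\<open>\<lambda>\<^sub>0\<close>) where
  "\<lambda>\<^sub>0 = sqrt 2 - 1"

lemma sink_exponent_pos: "\<lambda>\<^sub>0 > 0" and sink_exponent_square: "(\<lambda>\<^sub>0 + 1) ^ 2 = 2"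
  by (simp_all add: sink_exponent_def)

text \<open>For \<open>r \<ge> 2\<close> the end terms contribute \<open>2 * ctilde r\<close>, which
  cancels the \<open>- 2\<close> in the recurrence. For \<open>r = 1\<close> they are the whole sum,
  and the identity reduces to \<open>(\<lambda>\<^sub>0 + 1) ^ 2 = 2\<close>, whatever the value of
  \<open>ctilde 1\<close>.\<close>

lemma ctilde_convolution:
  "(\<Sum>k=0..r. ctilde k * ctilde (r - k)) = (real r * \<lambda>\<^sub>0 + 1) ^ 2 * ctilde r"
proof -
  consider "r = 0" | "r = 1" | n where "r = Suc (Suc n)"
    by (metis One_nat_def not0_implies_Suc)
  thus ?thesis
  proof cases
    case 2
    thus ?thesis using sink_exponent_square by (simp add: add.commute del: ctilde.simps(2))
  next
    case 3
    \<comment> \<open>The denominator in the recurrence is therefore positive and can be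
      cleared.\<close>
    have "1 < (real r * \<lambda>\<^sub>0 + 1) ^ 2 - 1"
    proof -
      have "1 * \<lambda>\<^sub>0 < real r * \<lambda>\<^sub>0"
        using sink_exponent_pos 3 by (intro mult_strict_right_mono) auto
      hence "\<lambda>\<^sub>0 + 1 < real r * \<lambda>\<^sub>0 + 1" by linarith
      hence "(\<lambda>\<^sub>0 + 1) ^ 2 < (real r * \<lambda>\<^sub>0 + 1) ^ 2"
        using sink_exponent_pos by (intro power_strict_mono) auto
      thus ?thesis by (simp add: sink_exponent_square)
    qed
    hence "(\<Sum>k=1..Suc n. ctilde k * ctilde (r - k)) = ((real r * \<lambda>\<^sub>0 + 1) ^ 2 - 2) * ctilde r"
      unfolding 3 by (simp add: sink_exponent_def del: of_nat_Suc)
    moreover have "{0..r} = insert 0 (insert r {1..Suc n})" using 3 by auto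
    ultimately show ?thesis
      using 3 ctilde.simps(1) by (simp add: algebra_simps del: ctilde.simps sum.cl_ivl_Suc)
  qed auto
qed

text \<open>\<open>type_a_fps\<close> and \<open>type_b_fps\<close> solve
  \<open>\<lambda>\<^sub>0 s h\<^sub>a' = h\<^sub>b\<^sup>2 - h\<^sub>a\<close>, \<open>\<lambda>\<^sub>0 s h\<^sub>b' = h\<^sub>a - h\<^sub>b\<close>, which makes every coefficient of
  \<open>h\<^sub>a\<^sup>a h\<^sub>b\<^sup>b\<close> an eigenfunction of the generator of the pair of counts.\<close>

definition type_b_fps :: "real fps" where
  "type_b_fps = Abs_fps ctilde"

definition type_a_fps :: "real fps" where
  "type_a_fps = Abs_fps (\<lambda>r. (real r * \<lambda>\<^sub>0 + 1) * ctilde r)"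

definition eigen_fps :: "nat \<Rightarrow> nat \<Rightarrow> real fps" where
  "eigen_fps a b = type_a_fps ^ a * type_b_fps ^ b"

definition eigen_coeff :: "nat \<Rightarrow> nat \<Rightarrow> nat \<Rightarrow> real" where
  "eigen_coeff r a b = fps_nth (eigen_fps a b) r"

lemma fps_nth_X_mult_deriv: "fps_nth (fps_X * fps_deriv f) n = of_nat n * fps_nth f n"
  for f :: "'a :: comm_semiring_1 fps"
  by (cases n) simp_all

lemma type_fps_ode:
  "fps_const \<lambda>\<^sub>0 * (fps_X * fps_deriv type_a_fps) = type_b_fps ^ 2 - type_a_fps"
  "fps_const \<lambda>\<^sub>0 * (fps_X * fps_deriv type_b_fps) = type_a_fps - type_b_fps"
proof -
  show "fps_const \<lambda>\<^sub>0 * (fps_X * fps_deriv type_b_fps) = type_a_fps - type_b_fps"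
    by (intro fps_ext, unfold fps_mult_left_const_nth fps_nth_X_mult_deriv)
      (simp add: type_a_fps_def type_b_fps_def algebra_simps)
  have "fps_nth (type_b_fps ^ 2) n = (real n * \<lambda>\<^sub>0 + 1) ^ 2 * ctilde n" for n
    using ctilde_convolution[of n] by (simp add: power2_eq_square[of "Abs_fps ctilde"] fps_mult_nth type_b_fps_def)
  thus "fps_const \<lambda>\<^sub>0 * (fps_X * fps_deriv type_a_fps) = type_b_fps ^ 2 - type_a_fps"
    by (intro fps_ext, unfold fps_mult_left_const_nth fps_nth_X_mult_deriv)
      (simp add: type_a_fps_def algebra_simps power2_eq_square)
qed

lemma eigen_fps_deriv:
  "fps_deriv (eigen_fps a b) =
     of_nat a * fps_deriv type_a_fps * type_a_fps ^ (a - 1) * type_b_fps ^ b +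
     of_nat b * fps_deriv type_b_fps * type_a_fps ^ a * type_b_fps ^ (b - 1)"
  unfolding eigen_fps_def by (simp add: fps_deriv_power' algebra_simps)

text \<open>The two jumps replace one factor \<open>type_a_fps\<close> by
  \<open>type_b_fps ^ 2\<close>, or one factor \<open>type_b_fps\<close> by
  \<open>type_a_fps\<close>. By the differential equations these changes are the two terms of the
  product rule.\<close>

lemma eigen_fps_generator:
  "of_nat a * (eigen_fps (a - 1) (b + 2) - eigen_fps a b) +
   of_nat b * (eigen_fps (a + 1) (b - 1) - eigen_fps a b) =
   fps_const \<lambda>\<^sub>0 * (fps_X * fps_deriv (eigen_fps a b))"
proof -
  let ?A = type_a_fps and ?B = type_b_fps
  have "of_nat a * (eigen_fps (a - 1) (b + 2) - eigen_fps a b) =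
      of_nat a * (?B ^ 2 - ?A) * ?A ^ (a - 1) * ?B ^ b"
    \<comment> \<open>For \<open>a = 0\<close> the truncated \<open>a - 1\<close> does no harm,
      because the factor \<open>of_nat a\<close> vanishes.\<close>
    by (cases a) (simp_all add: eigen_fps_def algebra_simps power2_eq_square)
  moreover have "of_nat b * (eigen_fps (a + 1) (b - 1) - eigen_fps a b) =
      of_nat b * (?A - ?B) * ?A ^ a * ?B ^ (b - 1)"
    by (cases b) (simp_all add: eigen_fps_def algebra_simps)
  ultimately show ?thesis
    unfolding eigen_fps_deriv type_fps_ode[symmetric] by (simp add: algebra_simps)
qed

lemma eigen_coeff_generator:
  "real a * (eigen_coeff r (a - 1) (b + 2) - eigen_coeff r a b) +
   real b * (eigen_coeff r (a + 1) (b - 1) - eigen_coeff r a b) = real r * \<lambda>\<^sub>0 * eigen_coeff r a b"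
  using arg_cong[OF eigen_fps_generator[of a b], of "\<lambda>f. fps_nth f r"]
  unfolding fps_mult_left_const_nth fps_nth_X_mult_deriv fps_add_nth fps_of_nat[symmetric]
  by (simp add: eigen_coeff_def)

text \<open>The chain starts at \<open>(1, 0)\<close>; this value is the source of the factor
  \<open>(real r * \<lambda>\<^sub>0 + 1) * ctilde r\<close> in the limiting moments.\<close>

lemma eigen_coeff_1_0: "eigen_coeff r 1 0 = (real r * \<lambda>\<^sub>0 + 1) * ctilde r"
  by (simp add: eigen_coeff_def eigen_fps_def type_a_fps_def)

section \<open>Logarithmic derivatives and growth of the eigenfunctions\<close>

text \<open>Logarithmic derivatives turn the exponents \<open>a\<close> and \<open>b\<close> into
  linear factors, which exposes the eigenfunctions as polynomials in the counts.\<close>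

definition type_a_logderiv :: "real fps" where
  "type_a_logderiv = fps_X * fps_deriv type_a_fps * inverse type_a_fps"

definition type_b_logderiv :: "real fps" where
  "type_b_logderiv = fps_X * fps_deriv type_b_fps * inverse type_b_fps"

text \<open>Up to the factor \<open>ctilde 1\<close> this is the eigenfunction for
  \<open>r = 1\<close>.\<close>

definition sink_weight :: "nat \<Rightarrow> nat \<Rightarrow> real" where
  "sink_weight a b = sqrt 2 * real a + real b"

lemma logderiv_nth:
  "fps_nth type_a_logderiv 0 = 0" "fps_nth type_b_logderiv 0 = 0"
  "fps_nth type_a_logderiv (Suc 0) = sqrt 2 * ctilde 1" "fps_nth type_b_logderiv (Suc 0) = ctilde 1"
  by (simp_all del: ctilde.simps(2) add: type_a_logderiv_def type_b_logderiv_def type_a_fps_def type_b_fps_def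
      fps_mult_nth sink_exponent_def)

lemma X_mult_deriv_eigen_fps:
  "fps_X * fps_deriv (eigen_fps a b) =
    (fps_const (real a) * type_a_logderiv + fps_const (real b) * type_b_logderiv) * eigen_fps a b"
proof -
  have a: "type_a_fps ^ a = inverse type_a_fps * type_a_fps ^ Suc a" 
   and b: "type_b_fps ^ a = inverse type_b_fps * type_b_fps ^ Suc a" for a
    using inverse_mult_eq_1[of type_a_fps] inverse_mult_eq_1[of type_b_fps]
    by (simp_all add: type_a_fps_def type_b_fps_def flip: mult.assoc)
  have "of_nat a * type_a_fps ^ (a - 1) = of_nat a * inverse type_a_fps * type_a_fps ^ a"
    using a[of "a - 1"] by (cases a) (simp_all only: mult.assoc diff_Suc_1 of_nat_0 mult_zero_left)
  moreover have "of_nat b * type_b_fps ^ (b - 1) = of_nat b * inverse type_b_fps * type_b_fps ^ b"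
    using b[of "b - 1"] by (cases b) (simp_all only: mult.assoc diff_Suc_1 of_nat_0 mult_zero_left)
  moreover have "fps_X * fps_deriv (eigen_fps a b) =
      fps_X * fps_deriv type_a_fps * type_b_fps ^ b * (of_nat a * type_a_fps ^ (a - 1)) +
      fps_X * fps_deriv type_b_fps * type_a_fps ^ a * (of_nat b * type_b_fps ^ (b - 1))"
    unfolding eigen_fps_deriv by (simp add: algebra_simps)
  ultimately show ?thesis
    by (simp only:) (simp add: eigen_fps_def type_a_logderiv_def type_b_logderiv_def fps_of_nat algebra_simps)
qed

definition logderiv_bound :: "nat \<Rightarrow> real" where
  "logderiv_bound k = \<bar>fps_nth type_a_logderiv k\<bar> + \<bar>fps_nth type_b_logderiv k\<bar>"

text \<open>Obtained by comparing coefficients in \<open>X_mult_deriv_eigen_fps\<close>. The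
  logarithmic derivatives have no constant term, so only coefficients of lower index occur on the
  right; each \<open>w k\<close> is linear in the counts.\<close>

lemma eigen_coeff_rec:
  obtains w where
    "\<And>r. real r * eigen_coeff r a b = (\<Sum>k=1..r. w k * eigen_coeff (r - k) a b)"
    "w 1 = ctilde 1 * sink_weight a b"
    "\<And>k. \<bar>w k\<bar> \<le> logderiv_bound k * (1 + real a + real b)"
proof -
  define w where "w k = real a * fps_nth type_a_logderiv k + real b * fps_nth type_b_logderiv k" for k
  show thesis
  proof (rule that[of w])
    fix r
    have "real r * eigen_coeff r a b = (\<Sum>k=0..r. w k * eigen_coeff (r - k) a b)"
      using arg_cong[OF X_mult_deriv_eigen_fps[of a b], of "\<lambda>f. fps_nth f r"]
      unfolding fps_nth_X_mult_deriv eigen_coeff_def by (simp add: fps_mult_nth[of "_ + _"] w_def)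
    also have "\<dots> = (\<Sum>k=1..r. w k * eigen_coeff (r - k) a b)"
      by (simp add: sum.atLeast_Suc_atMost w_def logderiv_nth)
    finally show "real r * eigen_coeff r a b = (\<Sum>k=1..r. w k * eigen_coeff (r - k) a b)" .
  next
    show "w 1 = ctilde 1 * sink_weight a b"
      by (simp add: w_def logderiv_nth sink_weight_def algebra_simps del: ctilde.simps)
  next
    fix k
    have "\<bar>w k\<bar> \<le> real a * \<bar>fps_nth type_a_logderiv k\<bar> + real b * \<bar>fps_nth type_b_logderiv k\<bar>"
      unfolding w_def by (rule order_trans[OF abs_triangle_ineq]) (simp add: abs_mult)
    also have "\<dots> \<le> logderiv_bound k * (1 + real a + real b)"
      unfolding logderiv_bound_def by (simp add: algebra_simps)
    finally show "\<bar>w k\<bar> \<le> logderiv_bound k * (1 + real a + real b)" .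
  qed
qed

lemma logderiv_bound_nonneg: "logderiv_bound k \<ge> 0"
  by (simp add: logderiv_bound_def)

text \<open>Each use of the recurrence costs one factor of order \<open>1 + a + b\<close> and lowers
  the index by at least 1.\<close>

lemma eigen_coeff_bound:
  "\<exists>C\<ge>0. \<forall>a b. \<bar>eigen_coeff r a b\<bar> \<le> C * (1 + real a + real b) ^ r"
proof (induction r rule: less_induct)
  case (less r)
  show ?case
  proof (cases "r = 0")
    case True
    thus ?thesis
      by (intro exI[of _ 1]) (simp add: eigen_coeff_def eigen_fps_def type_a_fps_def type_b_fps_def fps_power_zeroth)
  next
    case False
    from less obtain C where C: "\<And>j. j < r \<Longrightarrow> C j \<ge> 0"
      "\<And>j a b. j < r \<Longrightarrow> \<bar>eigen_coeff j a b\<bar> \<le> C j * (1 + real a + real b) ^ j"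
      by metis
    define D where "D = (\<Sum>k=1..r. logderiv_bound k * C (r - k))"
    have "\<bar>eigen_coeff r a b\<bar> \<le> D * (1 + real a + real b) ^ r" for a b
    proof -
      define S where "S = 1 + real a + real b"
      have S: "S \<ge> 1" by (simp add: S_def)
      obtain w where w: "\<And>r. real r * eigen_coeff r a b = (\<Sum>k=1..r. w k * eigen_coeff (r - k) a b)"
        "\<And>k. \<bar>w k\<bar> \<le> logderiv_bound k * S"
        by (rule eigen_coeff_rec[of a b, folded S_def]) blast
      have "\<bar>eigen_coeff r a b\<bar> \<le> real r * \<bar>eigen_coeff r a b\<bar>"
        using False by (simp add: mult_le_cancel_right1)
      also have "\<dots> = \<bar>\<Sum>k=1..r. w k * eigen_coeff (r - k) a b\<bar>"
        by (simp only: w(1)[symmetric] abs_mult abs_of_nat)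
      also have "\<dots> \<le> (\<Sum>k=1..r. \<bar>w k * eigen_coeff (r - k) a b\<bar>)"
        by (rule sum_abs)
      also have "\<dots> \<le> (\<Sum>k=1..r. logderiv_bound k * C (r - k) * S ^ r)"
      proof (rule sum_mono)
        fix k assume k: "k \<in> {1..r}"
        have "\<bar>w k * eigen_coeff (r - k) a b\<bar> \<le> (logderiv_bound k * S) * (C (r - k) * S ^ (r - k))"
          unfolding abs_mult using w(2)[of k] C(2)[of "r - k" a b] k False S logderiv_bound_nonneg[of k]
          by (intro mult_mono) (auto simp: S_def)
        also have "\<dots> = logderiv_bound k * C (r - k) * S ^ Suc (r - k)" by simp
        also have "\<dots> \<le> logderiv_bound k * C (r - k) * S ^ r"
          using k S C(1)[of "r - k"] logderiv_bound_nonneg[of k]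
          by (intro mult_left_mono power_increasing) auto
        finally show "\<bar>w k * eigen_coeff (r - k) a b\<bar> \<le> logderiv_bound k * C (r - k) * S ^ r" .
      qed
      finally show ?thesis by (simp add: D_def S_def sum_distrib_right)
    qed
    moreover have "D \<ge> 0"
      unfolding D_def using C(1) by (intro sum_nonneg mult_nonneg_nonneg logderiv_bound_nonneg) auto
    ultimately show ?thesis by blast
  qed
qed

text \<open>In the recurrence only the term \<open>k = 1\<close> keeps full order, and it
  contributes one factor of the linear form; the terms with \<open>k \<ge> 2\<close> lose at least
  one power of \<open>1 + a + b\<close>.\<close>

lemma eigen_coeff_leading_term:
  "\<exists>C\<ge>0. \<forall>a b. \<bar>fact r * eigen_coeff r a b - (ctilde 1 * sink_weight a b) ^ r\<bar> \<le> C * (1 + real a + real b) ^ (r - 1)"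
proof (induction r)
  case 0
  show ?case
    by (intro exI[of _ 0]) (simp add: eigen_coeff_def eigen_fps_def type_a_fps_def type_b_fps_def fps_power_zeroth)
next
  case (Suc r)
  then obtain C where C: "C \<ge> 0" "\<And>a b. \<bar>fact r * eigen_coeff r a b - (ctilde 1 * sink_weight a b) ^ r\<bar> \<le> C * (1 + real a + real b) ^ (r - 1)"
    by auto
  obtain B where B: "\<And>j. B j \<ge> 0" "\<And>j a b. \<bar>eigen_coeff j a b\<bar> \<le> B j * (1 + real a + real b) ^ j"
    using eigen_coeff_bound by metis
  define D where "D = logderiv_bound 1 * C + fact r * (\<Sum>k=2..Suc r. logderiv_bound k * B (Suc r - k))"
  have "\<bar>fact (Suc r) * eigen_coeff (Suc r) a b - (ctilde 1 * sink_weight a b) ^ Suc r\<bar>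
      \<le> D * (1 + real a + real b) ^ r" for a b
  proof -
    define S where "S = 1 + real a + real b"
    define x where "x = ctilde 1 * sink_weight a b"
    have S: "S \<ge> 1" by (simp add: S_def)
    obtain w where w: "\<And>r. real r * eigen_coeff r a b = (\<Sum>k=1..r. w k * eigen_coeff (r - k) a b)"
      "w 1 = x" "\<And>k. \<bar>w k\<bar> \<le> logderiv_bound k * S"
      by (rule eigen_coeff_rec[of a b, folded S_def x_def]) blast
    have "fact (Suc r) * eigen_coeff (Suc r) a b = fact r * (real (Suc r) * eigen_coeff (Suc r) a b)"
      by (simp add: algebra_simps)
    also have "\<dots> = fact r * (x * eigen_coeff r a b + (\<Sum>k=2..Suc r. w k * eigen_coeff (Suc r - k) a b))"
      unfolding w(1) by (subst sum.atLeast_Suc_atMost) (simp_all add: w(2)[simplified] numeral_2_eq_2)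
    finally have eq: "fact (Suc r) * eigen_coeff (Suc r) a b - x ^ Suc r = 
        x * (fact r * eigen_coeff r a b - x ^ r) + fact r * (\<Sum>k=2..Suc r. w k * eigen_coeff (Suc r - k) a b)"
      by (simp add: algebra_simps)
    have 1: "\<bar>x * (fact r * eigen_coeff r a b - x ^ r)\<bar> \<le> logderiv_bound 1 * C * S ^ r"
    \<comment> \<open>For \<open>r = 0\<close> the exponent \<open>r - 1\<close> is truncated, and
      the induction hypothesis would yield \<open>S\<close> where \<open>S ^ 0\<close> is required.
      The difference vanishes exactly in that case.\<close>
    proof (cases "r = 0")
      case True
      thus ?thesis using logderiv_bound_nonneg[of 1] C(1)
        by (simp add: eigen_coeff_def eigen_fps_def type_a_fps_def type_b_fps_def fps_power_zeroth)
    next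
      case False
      have "\<bar>x * (fact r * eigen_coeff r a b - x ^ r)\<bar> \<le> (logderiv_bound 1 * S) * (C * S ^ (r - 1))"
        unfolding abs_mult using w(2) w(3)[of 1] C(2)[of a b] S logderiv_bound_nonneg[of 1]
        by (intro mult_mono) (auto simp: S_def x_def)
      also have "\<dots> = logderiv_bound 1 * C * S ^ r"
        using False by (cases r) auto
      finally show ?thesis .
    qed
    have "\<bar>\<Sum>k=2..Suc r. w k * eigen_coeff (Suc r - k) a b\<bar> \<le> (\<Sum>k=2..Suc r. \<bar>w k * eigen_coeff (Suc r - k) a b\<bar>)"
      by (rule sum_abs)
    also have "\<dots> \<le> (\<Sum>k=2..Suc r. logderiv_bound k * B (Suc r - k) * S ^ r)"
    proof (rule sum_mono)
      fix k assume k: "k \<in> {2..Suc r}"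
      have "\<bar>w k * eigen_coeff (Suc r - k) a b\<bar> \<le> (logderiv_bound k * S) * (B (Suc r - k) * S ^ (Suc r - k))"
        unfolding abs_mult using w(3)[of k] B(2)[of "Suc r - k" a b] S logderiv_bound_nonneg[of k]
        by (intro mult_mono) (auto simp: S_def)
      also have "\<dots> = logderiv_bound k * B (Suc r - k) * S ^ Suc (Suc r - k)" by simp
      also have "\<dots> \<le> logderiv_bound k * B (Suc r - k) * S ^ r"
        using k S B(1)[of "Suc r - k"] logderiv_bound_nonneg[of k]
        by (intro mult_left_mono power_increasing) auto
      finally show "\<bar>w k * eigen_coeff (Suc r - k) a b\<bar> \<le> logderiv_bound k * B (Suc r - k) * S ^ r" .
    qed
    finally have "\<bar>\<Sum>k=2..Suc r. w k * eigen_coeff (Suc r - k) a b\<bar> \<le> (\<Sum>k=2..Suc r. logderiv_bound k * B (Suc r - k)) * S ^ r"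
      by (simp only: sum_distrib_right)
    hence 2: "\<bar>fact r * (\<Sum>k=2..Suc r. w k * eigen_coeff (Suc r - k) a b)\<bar>
        \<le> fact r * ((\<Sum>k=2..Suc r. logderiv_bound k * B (Suc r - k)) * S ^ r)"
      unfolding abs_mult by (intro mult_mono) auto
    have "\<bar>fact (Suc r) * eigen_coeff (Suc r) a b - x ^ Suc r\<bar> \<le>
        logderiv_bound 1 * C * S ^ r + fact r * ((\<Sum>k=2..Suc r. logderiv_bound k * B (Suc r - k)) * S ^ r)"
      unfolding eq using 1 2 by linarith
    also have "\<dots> = D * S ^ r" by (simp add: D_def algebra_simps)
    finally show ?thesis by (simp add: S_def x_def)
  qed
  moreover have "D \<ge> 0"
    unfolding D_def using C(1) B(1)
    by (intro add_nonneg_nonneg mult_nonneg_nonneg sum_nonneg logderiv_bound_nonneg) auto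
  ultimately show ?case by auto
qed

section \<open>Asymptotics of the moments\<close>

lemma sink_generator_eigen_coeff:
  "sink_generator (eigen_coeff r) = (\<lambda>a b. real r * \<lambda>\<^sub>0 * eigen_coeff r a b)"
  using eigen_coeff_generator by (intro ext) (simp add: sink_generator_def)

text \<open>By the eigenvalue equation, step \<open>Suc k\<close> multiplies the expectation by
  \<open>1 + r * \<lambda>\<^sub>0 / Suc k\<close>; the product of these factors is the Pochhammer
  quotient.\<close>

lemma sink_expectation_eigen_coeff:
  "sink_expectation k (eigen_coeff r) =
    (real r * \<lambda>\<^sub>0 + 1) * ctilde r * (pochhammer (real r * \<lambda>\<^sub>0 + 1) k / fact k)"
proof (induction k)
  case 0
  show ?case by (simp add: sink_expectation_0 eigen_coeff_1_0[simplified])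
next
  case (Suc k)
  have "sink_expectation (Suc k) (eigen_coeff r) =
      sink_expectation k (eigen_coeff r) * (1 + real r * \<lambda>\<^sub>0 / real (Suc k))"
    by (simp add: sink_expectation_Suc sink_generator_eigen_coeff sink_expectation_cmult algebra_simps del: of_nat_Suc)
  also have "1 + real r * \<lambda>\<^sub>0 / real (Suc k) = (real r * \<lambda>\<^sub>0 + 1 + real k) / real (Suc k)"
    by (simp add: field_simps)
  finally have "sink_expectation (Suc k) (eigen_coeff r) = sink_expectation k (eigen_coeff r) *
      ((real r * \<lambda>\<^sub>0 + 1 + real k) / real (Suc k))" .
  moreover have "A * (P / F) * (q / S) = A * (P * q / (S * F))" for A P F q S :: real
    by (simp add: mult_ac)
  ultimately show ?case by (simp only: Suc.IH pochhammer_Suc fact_Suc)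
qed

text \<open>Euler's limit for Gamma, shifted by
  \<open>pochhammer z n = z * pochhammer (z + 1) (n - 1)\<close>. The case \<open>z = 0\<close> is
  separate because of the division by \<open>z\<close>.\<close>

lemma pochhammer_over_fact_asymp:
  fixes z :: real
  assumes "z \<ge> 0"
  shows "(\<lambda>n. pochhammer (z + 1) (n - 1) / fact (n - 1) / real n powr z) \<longlonglongrightarrow> 1 / Gamma (z + 1)"
proof (cases "z = 0")
  case True
  have "eventually (\<lambda>n. pochhammer (z + 1) (n - 1) / fact (n - 1) / real n powr z = 1 / Gamma (z + 1)) sequentially"
    using eventually_gt_at_top[of 0]
    by eventually_elim (use True in \<open>simp add: pochhammer_fact[symmetric]\<close>)
  thus ?thesis by (rule tendsto_eventually)
next
  case False
  hence z: "z > 0" using assms by simp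
  have "(\<lambda>n. 1 / (z * Gamma_series' z n)) \<longlonglongrightarrow> 1 / (z * Gamma z)"
    using z Gamma_real_pos[OF z] by (intro tendsto_intros Gamma_series'_LIMSEQ) (simp del: Gamma_real_pos)
  also have "z * Gamma z = Gamma (z + 1)"
    using z by (subst Gamma_plus1) (auto simp: nonpos_Ints_def)
  finally have lim: "(\<lambda>n. 1 / (z * Gamma_series' z n)) \<longlonglongrightarrow> 1 / Gamma (z + 1)" .
  have "eventually (\<lambda>n. 1 / (z * Gamma_series' z n) = pochhammer (z + 1) (n - 1) / fact (n - 1) / real n powr z) sequentially"
    using eventually_gt_at_top[of 0]
  proof eventually_elim
    case (elim n)
    then obtain m where n: "n = Suc m" by (cases n) auto
    have "pochhammer z n = z * pochhammer (z + 1) (n - 1)"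
      by (simp add: n pochhammer_rec)
    thus ?case using z elim by (simp add: Gamma_series'_def powr_def)
  qed
  from Lim_transform_eventually[OF lim this] show ?thesis .
qed

definition degree_moment :: "nat \<Rightarrow> real" where
  "degree_moment r = fact r * (real r * \<lambda>\<^sub>0 + 1) * ctilde r / Gamma (real r * \<lambda>\<^sub>0 + 1)"

lemma eigen_coeff_expectation_LIMSEQ:
  "(\<lambda>n. fact r * sink_expectation (n - 1) (eigen_coeff r) / real n powr (real r * \<lambda>\<^sub>0)) \<longlonglongrightarrow> degree_moment r"
proof -
  have "(\<lambda>n. fact r * ((real r * \<lambda>\<^sub>0 + 1) * ctilde r) *
      (pochhammer (real r * \<lambda>\<^sub>0 + 1) (n - 1) / fact (n - 1) / real n powr (real r * \<lambda>\<^sub>0)))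
      \<longlonglongrightarrow> fact r * ((real r * \<lambda>\<^sub>0 + 1) * ctilde r) * (1 / Gamma (real r * \<lambda>\<^sub>0 + 1))"
    using sink_exponent_pos by (intro tendsto_intros pochhammer_over_fact_asymp) auto
  thus ?thesis by (simp add: sink_expectation_eigen_coeff degree_moment_def mult_ac)
qed

section \<open>Moments of the leading linear form\<close>

text \<open>The value of \<open>ctilde 1\<close> is the one for which this form equals the degree
  \<open>a + b\<close> on the line \<open>b = sqrt 2 * a\<close>.\<close>

definition sink_drift :: "nat \<Rightarrow> nat \<Rightarrow> real" where
  "sink_drift a b = ctilde 1 * sink_weight a b"

lemma ctilde_1_bounds: "ctilde 1 > 1 / 2" "ctilde 1 < 1"
proof -
  have "sqrt 2 > 1" by simp
  thus "ctilde 1 > 1 / 2" "ctilde 1 < 1" by (simp_all add: field_simps)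
qed

lemma sink_drift_nonneg: "sink_drift a b \<ge> 0"
  using ctilde_1_bounds by (simp add: sink_drift_def sink_weight_def del: ctilde.simps One_nat_def)

text \<open>Converts error bounds in powers of \<open>1 + a + b\<close> into moments of the drift;
  this is where \<open>ctilde 1 > 1 / 2\<close> enters.\<close>

lemma total_le_sink_drift: "1 + real a + real b \<le> 1 + 2 * sink_drift a b"
proof -
  have "1 * real a \<le> sqrt 2 * real a" by (intro mult_right_mono) auto
  hence "real a + real b \<le> 1 * sink_weight a b" by (simp add: sink_weight_def)
  also have "\<dots> \<le> (2 * ctilde 1) * sink_weight a b"
    using ctilde_1_bounds by (intro mult_right_mono) (auto simp: sink_weight_def simp del: ctilde.simps One_nat_def)
  finally show ?thesis by (simp add: sink_drift_def del: ctilde.simps One_nat_def)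
qed

lemma one_plus_power_le:
  fixes y :: real
  assumes "y \<ge> 0"
  shows "(1 + y) ^ m \<le> 2 ^ m * (1 + y ^ m)"
proof -
  have "(1 + y) ^ m \<le> (2 * max 1 y) ^ m"
    using assms by (intro power_mono) auto
  also have "\<dots> = 2 ^ m * max 1 y ^ m" by (simp add: power_mult_distrib)
  also have "max 1 y ^ m \<le> 1 + y ^ m"
    using assms by (auto simp: max_def)
  finally show ?thesis by simp
qed

text \<open>By induction: the power of order \<open>r\<close> differs from the eigenfunction, whose
  asymptotics are explicit, by an error of order \<open>r - 1\<close>. The previous moment shows
  that this error is smaller by a factor of order \<open>n powr \<lambda>\<^sub>0\<close>.\<close>

lemma sink_drift_moments_LIMSEQ:
  "(\<lambda>n. sink_expectation (n - 1) (\<lambda>a b. sink_drift a b ^ r) / real n powr (real r * \<lambda>\<^sub>0)) \<longlonglongrightarrow> degree_moment r"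
proof (induction r)
  case 0
  have "eventually (\<lambda>n. sink_expectation (n - 1) (\<lambda>a b. sink_drift a b ^ 0) / real n powr (real 0 * \<lambda>\<^sub>0) = degree_moment 0) sequentially"
    \<comment> \<open>The value at \<open>n = 0\<close> is excluded since
      \<open>0 powr 0 = 0\<close>.\<close>
    using eventually_gt_at_top[of 0]
    by eventually_elim (simp add: sink_expectation_const degree_moment_def)
  thus ?case by (rule tendsto_eventually)
next
  case (Suc m)
  define r where "r = Suc m"
  define N where "N j n = real n powr (real j * \<lambda>\<^sub>0)" for j n :: nat
  define err where "err a b = fact r * eigen_coeff r a b - sink_drift a b ^ r" for a b
  obtain C where C: "C \<ge> 0" "\<And>a b. \<bar>err a b\<bar> \<le> C * (1 + real a + real b) ^ m"
    using eigen_coeff_leading_term[of r] by (auto simp: err_def r_def sink_drift_def)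
  define K where "K = C * 2 ^ m"
  have err_le: "\<bar>err a b\<bar> \<le> K + K * 2 ^ m * sink_drift a b ^ m" for a b
  proof -
    have "\<bar>err a b\<bar> \<le> C * (1 + 2 * sink_drift a b) ^ m"
      using C(1) total_le_sink_drift[of a b] by (intro order_trans[OF C(2)] mult_left_mono power_mono) auto
    also have "\<dots> \<le> C * (2 ^ m * (1 + (2 * sink_drift a b) ^ m))"
      using C(1) sink_drift_nonneg[of a b] by (intro mult_left_mono one_plus_power_le) auto
    finally show ?thesis by (simp add: K_def algebra_simps power_mult_distrib)
  qed
  have "(\<lambda>n. sink_expectation (n - 1) err / N r n) \<longlonglongrightarrow> 0"
  proof (rule Lim_null_comparison)
    show "\<forall>\<^sub>F n in sequentially. norm (sink_expectation (n - 1) err / N r n) \<le>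
        K * real n powr (- (real r * \<lambda>\<^sub>0)) +
        K * 2 ^ m * (sink_expectation (n - 1) (\<lambda>a b. sink_drift a b ^ m) / N m n) * real n powr (- \<lambda>\<^sub>0)"
      using eventually_gt_at_top[of 0]
    proof eventually_elim
      case (elim n)
      have "\<bar>sink_expectation (n - 1) err\<bar> \<le> sink_expectation (n - 1) (\<lambda>a b. K + K * 2 ^ m * sink_drift a b ^ m)"
        by (rule order_trans[OF sink_expectation_abs_le sink_expectation_mono]) (rule err_le)
      also have "\<dots> = K + K * 2 ^ m * sink_expectation (n - 1) (\<lambda>a b. sink_drift a b ^ m)"
        by (simp add: sink_expectation_add sink_expectation_const sink_expectation_cmult)
      finally have "norm (sink_expectation (n - 1) err / N r n) \<le>
          (K + K * 2 ^ m * sink_expectation (n - 1) (\<lambda>a b. sink_drift a b ^ m)) / N r n"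
        using elim by (simp add: N_def divide_right_mono)
      also have "\<dots> = K * real n powr (- (real r * \<lambda>\<^sub>0)) +
        K * 2 ^ m * (sink_expectation (n - 1) (\<lambda>a b. sink_drift a b ^ m) / N m n) * real n powr (- \<lambda>\<^sub>0)"
      proof -
        have "real n powr (- (real r * \<lambda>\<^sub>0)) = 1 / N r n" "real n powr (- \<lambda>\<^sub>0) = 1 / real n powr \<lambda>\<^sub>0"
          by (simp_all only: N_def powr_minus_divide)
        moreover have "N r n = N m n * real n powr \<lambda>\<^sub>0"
          by (simp add: N_def r_def powr_add[symmetric] algebra_simps)
        ultimately show ?thesis by (simp add: add_divide_distrib)
      qed
      finally show ?case .
    qed
    have "(\<lambda>n. K * real n powr (- (real r * \<lambda>\<^sub>0)) +
        K * 2 ^ m * (sink_expectation (n - 1) (\<lambda>a b. sink_drift a b ^ m) / N m n) * real n powr (- \<lambda>\<^sub>0))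
      \<longlonglongrightarrow> K * 0 + K * 2 ^ m * degree_moment m * 0"
      unfolding N_def using sink_exponent_pos
      by (intro tendsto_intros Suc.IH tendsto_neg_powr filterlim_real_sequentially) (auto simp: r_def)
    thus "(\<lambda>n. K * real n powr (- (real r * \<lambda>\<^sub>0)) +
        K * 2 ^ m * (sink_expectation (n - 1) (\<lambda>a b. sink_drift a b ^ m) / N m n) * real n powr (- \<lambda>\<^sub>0)) \<longlonglongrightarrow> 0"
      by simp
  qed
  from tendsto_diff[OF eigen_coeff_expectation_LIMSEQ[of r] this]
  have "(\<lambda>n. fact r * sink_expectation (n - 1) (eigen_coeff r) / N r n - sink_expectation (n - 1) err / N r n)
      \<longlonglongrightarrow> degree_moment r"
    by (simp add: N_def)
  moreover have "fact r * sink_expectation k (eigen_coeff r) - sink_expectation k err =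
      sink_expectation k (\<lambda>a b. sink_drift a b ^ r)" for k
    unfolding err_def by (simp add: sink_expectation_diff sink_expectation_cmult)
  ultimately show ?case
    unfolding r_def[symmetric] by (simp add: N_def flip: diff_divide_distrib)
qed

text \<open>The second eigendirection of the mean dynamics; its eigenvalue \<open>-(\<lambda>\<^sub>0 + 2)\<close> is negative,
  so it is negligible against the drift.\<close>

definition sink_fluctuation :: "nat \<Rightarrow> nat \<Rightarrow> real" where
  "sink_fluctuation a b = real b - sqrt 2 * real a"

text \<open>The difference is linear and vanishes on \<open>b = sqrt 2 * a\<close> by the choice of
  \<open>ctilde 1\<close>, so it is a multiple of the fluctuation, with factor
  \<open>1 - ctilde 1\<close> between 0 and 1.\<close>

lemma degree_minus_drift_le: "\<bar>real (a + b) - sink_drift a b\<bar> \<le> \<bar>sink_fluctuation a b\<bar>"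
proof -
  have "real (a + b) - sink_drift a b = (1 - ctilde 1) * sink_fluctuation a b"
    by (simp add: sink_drift_def sink_weight_def sink_fluctuation_def field_simps)
  thus ?thesis
    using ctilde_1_bounds by (simp add: abs_mult mult_left_le_one_le del: ctilde.simps One_nat_def)
qed

lemma sink_generator_weight: "sink_generator sink_weight a b = \<lambda>\<^sub>0 * sink_weight a b"
proof -
  have "sink_generator sink_weight a b = real a * (2 - sqrt 2) + real b * (sqrt 2 - 1)"
    by (cases a; cases b) (simp_all add: sink_generator_def sink_weight_def algebra_simps)
  thus ?thesis by (simp add: sink_weight_def sink_exponent_def algebra_simps)
qed

text \<open>The jumps shift the fluctuation by \<open>2 + sqrt 2\<close> and
  \<open>- (1 + sqrt 2)\<close>. The cross terms combine to a negative multiple of its square, and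
  what remains are the squared jump sizes times the rates.\<close>

lemma sink_generator_fluctuation_square:
  "sink_generator (\<lambda>a b. sink_fluctuation a b ^ 2) a b \<le> 12 * sink_weight a b"
proof -
  define Y where "Y = sink_fluctuation a b"
  have a: "real a * (sink_fluctuation (a - 1) (b + 2) ^ 2 - Y ^ 2) =
      real a * ((Y + (2 + sqrt 2)) ^ 2 - Y ^ 2)"
    by (cases a) (simp_all add: Y_def sink_fluctuation_def algebra_simps)
  have b: "real b * (sink_fluctuation (a + 1) (b - 1) ^ 2 - Y ^ 2) =
      real b * ((Y - (1 + sqrt 2)) ^ 2 - Y ^ 2)"
    by (cases b) (simp_all add: Y_def sink_fluctuation_def algebra_simps)
  have "sink_generator (\<lambda>a b. sink_fluctuation a b ^ 2) a b =
      real a * ((Y + (2 + sqrt 2)) ^ 2 - Y ^ 2) + real b * ((Y - (1 + sqrt 2)) ^ 2 - Y ^ 2)"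
    unfolding sink_generator_def Y_def[symmetric] a b ..
  also have "\<dots> = - 2 * (1 + sqrt 2) * Y ^ 2 + (2 + sqrt 2) ^ 2 * real a + (1 + sqrt 2) ^ 2 * real b"
    unfolding Y_def sink_fluctuation_def by (simp add: power2_eq_square algebra_simps)
  also have "\<dots> \<le> (2 + sqrt 2) ^ 2 * real a + (1 + sqrt 2) ^ 2 * real b"
  proof -
    have "(- 2 * (1 + sqrt 2)) * Y ^ 2 \<le> 0" by (intro mult_nonpos_nonneg) auto
    thus ?thesis by linarith
  qed
  \<comment> \<open>A crude constant dominating both squared jumps in the proportions of
    \<open>sink_weight\<close>.\<close>
  also have "\<dots> \<le> (12 * sqrt 2) * real a + 12 * real b"
  proof (intro add_mono mult_right_mono)
    have s: "1 \<le> sqrt 2" "sqrt 2 \<le> 2" by (simp_all add: real_le_lsqrt)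
    have "(2 + sqrt 2) ^ 2 = 6 + 4 * sqrt 2" by (simp add: power2_eq_square algebra_simps)
    thus "(2 + sqrt 2) ^ 2 \<le> 12 * sqrt 2" using s(1) by linarith
    have "(1 + sqrt 2) ^ 2 = 3 + 2 * sqrt 2" by (simp add: power2_eq_square algebra_simps)
    thus "(1 + sqrt 2) ^ 2 \<le> 12" using s(2) by linarith
  qed auto
  finally show ?thesis by (simp add: sink_weight_def)
qed

text \<open>Subtracting \<open>12 / \<lambda>\<^sub>0\<close> times the weight, an eigenfunction
  with eigenvalue \<open>\<lambda>\<^sub>0\<close>, gives a function with nonpositive generator, so
  its mean never exceeds its initial value.\<close>

lemma sink_expectation_fluctuation_square:
  "sink_expectation k (\<lambda>a b. sink_fluctuation a b ^ 2) \<le> 2 + 12 / \<lambda>\<^sub>0 * sink_expectation k sink_weight"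
proof -
  define V where "V a b = sink_fluctuation a b ^ 2 - 12 / \<lambda>\<^sub>0 * sink_weight a b" for a b
  have gen: "sink_generator V a b \<le> 0" for a b
  proof -
    have "sink_generator V a b = sink_generator (\<lambda>a b. sink_fluctuation a b ^ 2) a b -
        12 / \<lambda>\<^sub>0 * sink_generator sink_weight a b"
      by (simp add: sink_generator_def V_def algebra_simps)
    thus ?thesis
      using sink_generator_fluctuation_square[of a b] sink_exponent_pos by (simp add: sink_generator_weight)
  qed
  have "sink_expectation k V \<le> V 1 0"
  proof (induction k)
    case (Suc k)
    have "sink_expectation k (sink_generator V) \<le> sink_expectation k (\<lambda>a b. 0)"
      by (intro sink_expectation_mono gen)
    hence "sink_expectation k (sink_generator V) / real (Suc k) \<le> 0"
      by (simp add: sink_expectation_const divide_le_0_iff)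
    with Suc show ?case by (simp add: sink_expectation_Suc)
  qed (simp add: sink_expectation_0)
  also have "V 1 0 \<le> 2"
    using sink_exponent_pos by (simp add: V_def sink_fluctuation_def sink_weight_def)
  finally show ?thesis
    by (simp add: V_def[abs_def] sink_expectation_diff sink_expectation_cmult[of _ "12 / \<lambda>\<^sub>0", simplified])
qed

text \<open>The mean square is only of order \<open>n powr \<lambda>\<^sub>0\<close>, so the mean
  absolute value is of the order of its square root.\<close>

lemma sink_fluctuation_LIMSEQ:
  "(\<lambda>n. sink_expectation (n - 1) (\<lambda>a b. \<bar>sink_fluctuation a b\<bar>) / real n powr \<lambda>\<^sub>0) \<longlonglongrightarrow> 0"
proof (rule Lim_null_comparison)
  define v where "v n = 2 * real n powr (- 2 * \<lambda>\<^sub>0) + 12 / \<lambda>\<^sub>0 / ctilde 1 *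
    (sink_expectation (n - 1) (\<lambda>a b. sink_drift a b ^ 1) / real n powr (real 1 * \<lambda>\<^sub>0)) * real n powr (- \<lambda>\<^sub>0)" for n
  have "v \<longlonglongrightarrow> 2 * 0 + 12 / \<lambda>\<^sub>0 / ctilde 1 * degree_moment 1 * 0"
    unfolding v_def using sink_exponent_pos
    by (intro tendsto_intros sink_drift_moments_LIMSEQ tendsto_neg_powr filterlim_real_sequentially) auto
  from tendsto_real_sqrt[OF this] show "(\<lambda>n. sqrt (v n)) \<longlonglongrightarrow> 0" by simp
  show "\<forall>\<^sub>F n in sequentially.
      norm (sink_expectation (n - 1) (\<lambda>a b. \<bar>sink_fluctuation a b\<bar>) / real n powr \<lambda>\<^sub>0) \<le> sqrt (v n)"
    using eventually_gt_at_top[of 0]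
  proof eventually_elim
    case (elim n)
    define e where "e = sink_expectation (n - 1) (\<lambda>a b. \<bar>sink_fluctuation a b\<bar>)"
    have "0 = sink_expectation (n - 1) (\<lambda>a b. 0)" by (simp add: sink_expectation_const)
    \<comment> \<open>Nonnegativity of the variance of the absolute fluctuation, which bounds
      \<open>e ^ 2\<close> by the mean square.\<close>
    also have "\<dots> \<le> sink_expectation (n - 1) (\<lambda>a b. (\<bar>sink_fluctuation a b\<bar> - e) ^ 2)"
      by (intro sink_expectation_mono) auto
    also have "(\<lambda>a b. (\<bar>sink_fluctuation a b\<bar> - e) ^ 2) =
        (\<lambda>a b. sink_fluctuation a b ^ 2 - (2 * e) * \<bar>sink_fluctuation a b\<bar> + e ^ 2)"
      by (intro ext) (simp add: power2_diff algebra_simps)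
    also have "sink_expectation (n - 1) \<dots> = sink_expectation (n - 1) (\<lambda>a b. sink_fluctuation a b ^ 2) - e ^ 2"
      by (simp only: sink_expectation_add sink_expectation_diff sink_expectation_cmult sink_expectation_const flip: e_def)
        (simp add: power2_eq_square)
    finally have "e ^ 2 \<le> 2 + 12 / \<lambda>\<^sub>0 * sink_expectation (n - 1) sink_weight"
      using sink_expectation_fluctuation_square[of "n - 1"] by linarith
    also have "sink_expectation (n - 1) sink_weight = sink_expectation (n - 1) sink_drift / ctilde 1"
      using ctilde_1_bounds sink_expectation_cmult[of "n - 1" "ctilde 1" sink_weight]
      by (simp add: sink_drift_def[abs_def] del: ctilde.simps One_nat_def)
    finally have "e ^ 2 / (real n powr \<lambda>\<^sub>0) ^ 2 \<le>
        (2 + 12 / \<lambda>\<^sub>0 * (sink_expectation (n - 1) sink_drift / ctilde 1)) / (real n powr \<lambda>\<^sub>0) ^ 2"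
      by (intro divide_right_mono) auto
    also have "\<dots> = v n"
    proof -
      have "real n powr (- 2 * \<lambda>\<^sub>0) = 1 / (real n powr \<lambda>\<^sub>0) ^ 2"
        "real n powr (- \<lambda>\<^sub>0) = 1 / real n powr \<lambda>\<^sub>0"
        using elim by (simp_all add: powr_minus_divide powr_power mult.commute)
      thus ?thesis
        by (simp add: v_def add_divide_distrib power2_eq_square del: ctilde.simps)
    qed
    finally have "(e / real n powr \<lambda>\<^sub>0) ^ 2 \<le> v n" by (simp add: power_divide)
    hence "sqrt ((e / real n powr \<lambda>\<^sub>0) ^ 2) \<le> sqrt (v n)" by (rule real_sqrt_le_mono)
    thus ?case by (simp only: real_sqrt_abs real_norm_def e_def)
  qed
qed

section \<open>Growth of the limiting moments and convergence\<close>

lemma sink_exponent_bounds: "2 / 5 < \<lambda>\<^sub>0" "\<lambda>\<^sub>0 < 1"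
proof -
  have "(7 / 5 :: real) < sqrt 2" by (rule real_less_rsqrt) (simp add: power2_eq_square)
  moreover have "sqrt 2 < (2 :: real)" by (rule real_less_lsqrt) auto
  ultimately show "2 / 5 < \<lambda>\<^sub>0" "\<lambda>\<^sub>0 < 1" by (simp_all add: sink_exponent_def)
qed

text \<open>The convolution has \<open>r - 1\<close> terms, each at most
  \<open>(4 / 5) ^ 2 * 2 ^ r\<close>, while the denominator is at least
  \<open>4 / 5 * (r - 1)\<close>. The factor \<open>4 / 5\<close> is what lets the induction
  close.\<close>

lemma ctilde_bounds_aux: "r \<ge> 1 \<Longrightarrow> 0 \<le> ctilde r \<and> ctilde r \<le> 4 / 5 * 2 ^ r"
proof (induction r rule: less_induct)
  case (less r)
  show ?case
  proof (cases "r = 1")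
    case True
    thus ?thesis using ctilde_1_bounds by (simp del: ctilde.simps(2))
  next
    case False
    with less.prems have "2 \<le> r" by simp
    then obtain n where "r = 2 + n" using le_Suc_ex by blast
    hence r: "r = Suc (Suc n)" by simp
    define q where "q = (real r * \<lambda>\<^sub>0 + 1) ^ 2 - 2"
    define S where "S = (\<Sum>k=1..Suc n. ctilde k * ctilde (r - k))"
    have c: "ctilde r = S / q" 
      by (simp only: r ctilde.simps(3) q_def S_def sink_exponent_def mult_1_left times_divide_eq_left)
    have q: "q \<ge> 4 / 5 * real (Suc n)"
    proof -
      have "real r * (2 / 5) + 1 \<le> real r * \<lambda>\<^sub>0 + 1"
        using sink_exponent_bounds by (intro add_right_mono mult_left_mono) auto
      hence "(real r * (2 / 5) + 1) ^ 2 \<le> (real r * \<lambda>\<^sub>0 + 1) ^ 2"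
        by (intro power_mono) auto
      moreover have "(real r * (2 / 5) + 1) ^ 2 - 2 = 4 / 5 * real (Suc n) + (4 / 25 * real r ^ 2 - 1 / 5)"
        unfolding r by (simp add: power2_eq_square field_simps)
      moreover have "4 \<le> real r ^ 2" using power_mono[of 2 "real r" 2] by (simp add: r)
      ultimately show ?thesis unfolding q_def by linarith
    qed
    have "S \<le> (\<Sum>k=1..Suc n. 16 / 25 * 2 ^ r)"
      unfolding S_def
    proof (rule sum_mono)
      fix k assume k: "k \<in> {1..Suc n}"
      have "ctilde k * ctilde (r - k) \<le> (4 / 5 * 2 ^ k) * (4 / 5 * 2 ^ (r - k))"
        using k less.IH[of k] less.IH[of "r - k"] by (intro mult_mono) (auto simp: r)
      also have "\<dots> = 16 / 25 * 2 ^ (k + (r - k))" by (simp add: power_add)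
      also have "k + (r - k) = r" using k by (simp add: r)
      finally show "ctilde k * ctilde (r - k) \<le> 16 / 25 * 2 ^ r" .
    qed
    also have "(\<Sum>k=1..Suc n. 16 / 25 * 2 ^ r) = 4 / 5 * 2 ^ r * (4 / 5 * real (Suc n))"
      by (simp del: of_nat_Suc)
    also have "\<dots> \<le> 4 / 5 * 2 ^ r * q" by (intro mult_left_mono q) simp
    finally have "S \<le> 4 / 5 * 2 ^ r * q" .
    moreover have "S \<ge> 0"
      unfolding S_def using less.IH by (intro sum_nonneg mult_nonneg_nonneg) (auto simp: r)
    moreover have "q > 0" using q by simp
    ultimately show ?thesis unfolding c by (simp add: pos_divide_le_eq)
  qed
qed

lemma ctilde_bounds: "0 \<le> ctilde r" "ctilde r \<le> 2 ^ r"
proof -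
  have "0 \<le> ctilde r \<and> ctilde r \<le> 2 ^ r"
  proof (cases "r = 0")
    case False
    hence "0 \<le> ctilde r \<and> ctilde r \<le> 4 / 5 * 2 ^ r" by (intro ctilde_bounds_aux) simp
    moreover have "4 / 5 * 2 ^ r \<le> (2 ^ r :: real)" by simp
    ultimately show ?thesis by linarith
  qed simp
  thus "0 \<le> ctilde r" "ctilde r \<le> 2 ^ r" by auto
qed

text \<open>Gamma dominates the factorial of the integer part \<open>N r\<close> of
  \<open>r * \<lambda>\<^sub>0\<close>. As \<open>\<lambda>\<^sub>0 > 1 / 3\<close>, the power is at
  most \<open>q ^ 3 * (q ^ 3) ^ N r\<close>, which loses against this factorial.\<close>

lemma power_over_Gamma_LIMSEQ:
  fixes q :: real
  assumes q: "q \<ge> 1"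
  shows "(\<lambda>r. q ^ r / Gamma (real r * \<lambda>\<^sub>0 + 1)) \<longlonglongrightarrow> 0"
proof (rule Lim_null_comparison)
  define N where "N r = nat \<lfloor>real r * \<lambda>\<^sub>0\<rfloor>" for r
  have N_top: "filterlim N at_top sequentially"
    unfolding N_def using sink_exponent_pos
    by (intro filterlim_compose[OF filterlim_nat_sequentially] filterlim_compose[OF filterlim_floor_sequentially]
        filterlim_at_top_mult_tendsto_pos[OF tendsto_const] filterlim_real_sequentially) auto
  have "(\<lambda>n. inverse (fact n) * (q ^ 3) ^ n) \<longlonglongrightarrow> 0"
    by (rule summable_LIMSEQ_zero[OF summable_exp])
  from tendsto_mult_right_zero[OF filterlim_compose[OF this N_top], of "q ^ 3"]
  show "(\<lambda>r. q ^ 3 * (inverse (fact (N r)) * (q ^ 3) ^ N r)) \<longlonglongrightarrow> 0" .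
  show "\<forall>\<^sub>F r in sequentially. norm (q ^ r / Gamma (real r * \<lambda>\<^sub>0 + 1)) \<le>
      q ^ 3 * (inverse (fact (N r)) * (q ^ 3) ^ N r)"
    \<comment> \<open>From \<open>r \<ge> 3\<close> on, \<open>N r \<ge> 1\<close>, so both Gamma
      arguments are at least 2, where Gamma is increasing.\<close>
    using eventually_ge_at_top[of 3]
  proof eventually_elim
    case (elim r)
    have "3 * (2 / 5) \<le> real r * \<lambda>\<^sub>0"
      using elim sink_exponent_bounds by (intro mult_mono) auto
    hence N: "real (N r) \<le> real r * \<lambda>\<^sub>0" "real r * \<lambda>\<^sub>0 < real (N r) + 1" "N r \<ge> 1"
      unfolding N_def by (auto simp: le_nat_iff le_floor_iff)
    have "fact (N r) = Gamma (real (N r) + 1)" by (simp add: Gamma_fact add.commute)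
    also have "\<dots> \<le> Gamma (real r * \<lambda>\<^sub>0 + 1)"
    proof (cases "real (N r) = real r * \<lambda>\<^sub>0")
      case False
      thus ?thesis using N by (intro less_imp_le Gamma_real_strict_mono) auto
    qed simp
    finally have Gam: "fact (N r) \<le> Gamma (real r * \<lambda>\<^sub>0 + 1)" .
    have "real r * (1 / 3) \<le> real r * \<lambda>\<^sub>0"
      using sink_exponent_bounds by (intro mult_left_mono) auto
    hence "r \<le> 3 + 3 * N r" using N(2) by linarith
    hence "q ^ r \<le> q ^ (3 + 3 * N r)" using q by (intro power_increasing)
    also have "\<dots> = q ^ 3 * (q ^ 3) ^ N r" by (simp add: power_add power_mult)
    finally have "q ^ r / Gamma (real r * \<lambda>\<^sub>0 + 1) \<le> q ^ 3 * (q ^ 3) ^ N r / fact (N r)"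
      using Gam q by (intro frac_le) auto
    moreover have "Gamma (real r * \<lambda>\<^sub>0 + 1) > 0" using Gam by (rule less_le_trans[OF fact_gt_zero])
    ultimately show ?case using q by (simp add: field_simps)
  qed
qed

lemma degree_moment_growth: "(\<lambda>r. t ^ r * degree_moment r / fact r) \<longlonglongrightarrow> 0"
proof (rule Lim_null_comparison)
  \<comment> \<open>Both \<open>ctilde r\<close> and \<open>r * \<lambda>\<^sub>0 + 1\<close> are at
    most \<open>2 ^ r\<close>, which gives the factor 4; the added 1 ensures
    \<open>q \<ge> 1\<close>.\<close>
  define q where "q = 4 * (\<bar>t\<bar> + 1)"
  show "(\<lambda>r. q ^ r / Gamma (real r * \<lambda>\<^sub>0 + 1)) \<longlonglongrightarrow> 0"
    by (rule power_over_Gamma_LIMSEQ) (simp add: q_def)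
  have "norm (t ^ r * degree_moment r / fact r) \<le> q ^ r / Gamma (real r * \<lambda>\<^sub>0 + 1)" for r
  proof -
    have G: "Gamma (real r * \<lambda>\<^sub>0 + 1) > 0"
      using sink_exponent_pos by (intro Gamma_real_pos add_nonneg_pos) auto
    have "real r * \<lambda>\<^sub>0 \<le> real r * 1" using sink_exponent_bounds by (intro mult_left_mono) auto
    moreover have "real r + 1 \<le> 2 ^ r"
      using of_nat_mono[OF less_exp[of r, THEN Suc_leI], where ?'a = real] by simp
    ultimately have l: "real r * \<lambda>\<^sub>0 + 1 \<le> 2 ^ r" by simp
    have nn: "0 \<le> real r * \<lambda>\<^sub>0 + 1" using sink_exponent_pos by simp
    have "norm (t ^ r * degree_moment r / fact r) =
        \<bar>t\<bar> ^ r * ((real r * \<lambda>\<^sub>0 + 1) * ctilde r) / Gamma (real r * \<lambda>\<^sub>0 + 1)"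
      using G nn ctilde_bounds(1)[of r] by (simp add: degree_moment_def abs_mult power_abs)
    also have "\<dots> \<le> (\<bar>t\<bar> + 1) ^ r * (2 ^ r * 2 ^ r) / Gamma (real r * \<lambda>\<^sub>0 + 1)"
      using G nn l ctilde_bounds[of r] by (intro divide_right_mono mult_mono power_mono) auto
    also have "(\<bar>t\<bar> + 1) ^ r * (2 ^ r * 2 ^ r) = q ^ r"
      by (simp add: q_def power_mult_distrib[symmetric] algebra_simps)
    finally show ?thesis .
  qed
  thus "\<forall>\<^sub>F r in sequentially. norm (t ^ r * degree_moment r / fact r) \<le> q ^ r / Gamma (real r * \<lambda>\<^sub>0 + 1)"
    by simp
qed

section \<open>From the linear form to the degree\<close>

lemma iexp_Lipschitz: "cmod (iexp u - iexp v) \<le> \<bar>u - v\<bar>"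
proof -
  have "iexp u - iexp v = iexp v * (iexp (u - v) - 1)"
    by (simp add: algebra_simps flip: exp_add)
  hence "cmod (iexp u - iexp v) = cmod (iexp (u - v) - 1)"
    by (simp add: norm_mult)
  also have "\<dots> \<le> \<bar>u - v\<bar>" using iexp_approx1[of "u - v" 0] by simp
  finally show ?thesis .
qed

text \<open>Closeness in mean makes characteristic functions close, which carries the limit law from
  the linear form over to the degree.\<close>

lemma char_distr_diff_le:
  fixes p :: "'a pmf" and X Y :: "'a \<Rightarrow> real"
  assumes "finite (set_pmf p)"
  shows "cmod (char (distr p borel X) t - char (distr p borel Y) t) \<le>
    \<bar>t\<bar> * measure_pmf.expectation p (\<lambda>x. \<bar>X x - Y x\<bar>)"
proof -
  note int = integrable_measure_pmf_finite[OF assms]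
  have "char (distr p borel X) t - char (distr p borel Y) t =
      measure_pmf.expectation p (\<lambda>x. iexp (t * X x) - iexp (t * Y x))"
    by (simp add: char_def integral_distr int)
  also have "cmod \<dots> \<le> measure_pmf.expectation p (\<lambda>x. cmod (iexp (t * X x) - iexp (t * Y x)))"
    by (rule integral_norm_bound)
  also have "\<dots> \<le> measure_pmf.expectation p (\<lambda>x. \<bar>t\<bar> * \<bar>X x - Y x\<bar>)"
    using iexp_Lipschitz[of "t * X _" "t * Y _"]
    by (intro integral_mono int) (simp add: abs_mult flip: right_diff_distrib)
  finally show ?thesis by simp
qed

theorem theorem5:
  shows "\<exists>M. real_distribution M \<and>
     (\<forall>r::nat. integrable M (\<lambda>x. x ^ r) \<and>
        (\<integral>x. x ^ r \<partial>M) =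
          fact r * (real r * (sqrt 2 - 1) + 1) * ctilde r / Gamma (real r * (sqrt 2 - 1) + 1)) \<and>
     (\<forall>M'. real_distribution M' \<longrightarrow>
        (\<forall>r::nat. integrable M' (\<lambda>x. x ^ r) \<and> (\<integral>x. x ^ r \<partial>M') = (\<integral>x. x ^ r \<partial>M))
        \<longrightarrow> M' = M) \<and>
     weak_conv_m scaled_sink_degree M"
proof -
  \<comment> \<open>\<open>X\<close> is the scaled linear form, to which the method of moments
    applies; \<open>Y\<close> is the scaled degree.\<close>
  define X where "X n G = sink_drift (sink_edges_a G) (sink_edges_b G) / real n powr \<lambda>\<^sub>0" for n G
  define Y where "Y n G = real (indeg G sp_sink) / real n powr \<lambda>\<^sub>0" for n G
  define \<mu> where "\<mu> n = distr (sp_network n) borel (X n)" for n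
  define \<nu> where "\<nu> n = distr (sp_network n) borel (Y n)" for n
  have \<mu>: "real_distribution (\<mu> n)" and \<nu>: "real_distribution (\<nu> n)" for n
    by (simp_all add: \<mu>_def \<nu>_def prob_space.real_distribution_distr[OF measure_pmf.prob_space_axioms])
  have fin: "finite (set_pmf (sp_network n))" for n
    by (simp add: sp_network_def finite_sp_net_aux)
  have int: "integrable (\<mu> n) (\<lambda>x. x ^ r)" for n r
    by (simp add: \<mu>_def integrable_distr_eq integrable_measure_pmf_finite fin)
  have lim: "(\<lambda>n. \<integral>x. x ^ r \<partial>\<mu> n) \<longlonglongrightarrow> degree_moment r" for r
  proof (rule Lim_transform_eventually[OF sink_drift_moments_LIMSEQ])
    show "\<forall>\<^sub>F n in sequentially. sink_expectation (n - 1) (\<lambda>a b. sink_drift a b ^ r) / real n powr (real r * \<lambda>\<^sub>0) =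
        (\<integral>x. x ^ r \<partial>\<mu> n)"
      using eventually_gt_at_top[of 0]
      by eventually_elim
        (simp add: \<mu>_def integral_distr X_def sink_expectation_def sp_network_def power_divide powr_power)
  qed
  have growth: "(\<lambda>k. t ^ (2 * k) * degree_moment (2 * k) / fact (2 * k)) \<longlonglongrightarrow> 0" for t
    using LIMSEQ_subseq_LIMSEQ[OF degree_moment_growth[of t], of "\<lambda>k. 2 * k"]
    by (simp add: strict_mono_def o_def)
  obtain M where M: "real_distribution M" "\<And>r. integrable M (\<lambda>x. x ^ r)"
    "\<And>r. (\<integral>x. x ^ r \<partial>M) = degree_moment r" "weak_conv_m \<mu> M"
    using method_of_moments[of \<mu> degree_moment, OF \<mu> int lim growth] by blast
  have "weak_conv_m \<nu> M"
  \<comment> \<open>The characteristic functions of \<open>\<nu>\<close> and \<open>\<mu>\<close>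
    differ by at most a multiple of the scaled mean fluctuation, so they share their limit.\<close>
  proof (rule levy_continuity[OF \<nu> M(1)])
    fix t
    have "(\<lambda>n. char (\<nu> n) t - char (\<mu> n) t) \<longlonglongrightarrow> 0"
    proof (rule Lim_null_comparison)
      show "(\<lambda>n. \<bar>t\<bar> * (sink_expectation (n - 1) (\<lambda>a b. \<bar>sink_fluctuation a b\<bar>) / real n powr \<lambda>\<^sub>0)) \<longlonglongrightarrow> 0"
        by (intro tendsto_mult_right_zero sink_fluctuation_LIMSEQ)
      have "cmod (char (\<nu> n) t - char (\<mu> n) t) \<le>
          \<bar>t\<bar> * (sink_expectation (n - 1) (\<lambda>a b. \<bar>sink_fluctuation a b\<bar>) / real n powr \<lambda>\<^sub>0)" for n
      proof -
        have "cmod (char (\<nu> n) t - char (\<mu> n) t) \<le> \<bar>t\<bar> * measure_pmf.expectation (sp_network n) (\<lambda>G. \<bar>Y n G - X n G\<bar>)"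
          unfolding \<mu>_def \<nu>_def by (rule char_distr_diff_le[OF fin])
        also have "measure_pmf.expectation (sp_network n) (\<lambda>G. \<bar>Y n G - X n G\<bar>) \<le>
            measure_pmf.expectation (sp_network n)
              (\<lambda>G. \<bar>sink_fluctuation (sink_edges_a G) (sink_edges_b G)\<bar> / real n powr \<lambda>\<^sub>0)"
        proof (intro integral_mono integrable_measure_pmf_finite fin)
          fix G
          have "\<bar>Y n G - X n G\<bar> = \<bar>real (sink_edges_a G + sink_edges_b G) - sink_drift (sink_edges_a G) (sink_edges_b G)\<bar> / real n powr \<lambda>\<^sub>0"
            by (simp add: X_def Y_def indeg_sink_eq flip: diff_divide_distrib)
          also have "\<dots> \<le> \<bar>sink_fluctuation (sink_edges_a G) (sink_edges_b G)\<bar> / real n powr \<lambda>\<^sub>0"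
            by (intro divide_right_mono degree_minus_drift_le) auto
          finally show "\<bar>Y n G - X n G\<bar> \<le> \<bar>sink_fluctuation (sink_edges_a G) (sink_edges_b G)\<bar> / real n powr \<lambda>\<^sub>0" .
        qed
        also have "\<dots> = sink_expectation (n - 1) (\<lambda>a b. \<bar>sink_fluctuation a b\<bar>) / real n powr \<lambda>\<^sub>0"
          by (simp add: sink_expectation_def sp_network_def)
        finally show ?thesis by (simp add: mult_left_mono)
      qed
      thus "\<forall>\<^sub>F n in sequentially. cmod (char (\<nu> n) t - char (\<mu> n) t) \<le>
          \<bar>t\<bar> * (sink_expectation (n - 1) (\<lambda>a b. \<bar>sink_fluctuation a b\<bar>) / real n powr \<lambda>\<^sub>0)"
        by simp
    qed
    from tendsto_add[OF this levy_continuity1[OF \<mu> M(1,4), of t]]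
    show "(\<lambda>n. char (\<nu> n) t) \<longlonglongrightarrow> char M t" by simp
  qed
  \<comment> \<open>\<open>scaled_sink_degree n\<close> carries the discrete sigma-algebra, so it is not a \<open>real_distribution\<close>;
    weak convergence only sees its distribution function.\<close>
  moreover have "cdf (scaled_sink_degree n) = cdf (\<nu> n)" for n
    by (intro ext) (simp add: cdf_def scaled_sink_degree_def \<nu>_def Y_def[abs_def] measure_distr sink_exponent_def)
  ultimately have "weak_conv_m scaled_sink_degree M"
    by (simp add: weak_conv_m_def)
  moreover have "M' = M"
    if "real_distribution M'" "\<forall>r::nat. integrable M' (\<lambda>x. x ^ r) \<and> (\<integral>x. x ^ r \<partial>M') = (\<integral>x. x ^ r \<partial>M)" for M'
    using that M growth by (intro moments_determine_distribution) auto
  ultimately show ?thesis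
    using M(1,2,3) unfolding degree_moment_def sink_exponent_def by blast
qed

end
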